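(* Let $G$ be the automorphism group of a countable saturated first-order structure $M$ with universe a countably infinite set $\Omega$, such that $G$ has locally finite algebraic closure. Assume that algebraic independence $\mathop{\perp}^{a}$ satisfies base monotonicity. Then the topology of pointwise convergence $\tau_{pw}$ is a minimal Hausdorff semigroup topology on $\overline{G}$, i.e. there is no Hausdorff topology strictly coarser than $\tau_{pw}$ on $\overline{G}$ for which composition $\overline{G}\times\overline{G}\to\overline{G}$ is continuous.
   Context: $\Omega^\Omega$ carries the topology of pointwise convergence $\tau_{pw}$ (product of discrete topologies); $\overline{G}$ is the closure of $G$ in $\Omega^\Omega$, which for $M$ countable saturated equals the monoid of elementary self-embeddings of $M$. For finite $B\subseteq\Omega$, $G_B$ is the pointwise stabiliser of $B$ and $\mathrm{acl}(B)$ is the set of points with finite $G_B$-orbit; locally finite algebraic closure means $\mathrm{acl}(B)$ is finite for all finite $B$. For finite $A,B,C\subseteq\Omega$, algebraic independence is defined by $A\mathop{\perp}^a_C B$ iff $\mathrm{acl}(A\cup C)\cap\mathrm{acl}(B\cup C)=\mathrm{acl}(C)$. Base monotonicity of $\mathop{\perp}^a$ means: for all finite $A$ and finite $B\subseteq C\subseteq D\subseteq\Omega$, if $A\mathop{\perp}^a_B D$ then $A\mathop{\perp}^a_C D$. *)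

theory Defs
  imports "HOL-Analysis.Analysis" "HOL-Library.Equipollence"
begin

section \<open>First-order languages and structures\<close>

text \<open>The symbols of a language form subsets of the types \<open>'f\<close> and \<open>'r\<close>, so that a language
  may have no function symbols or no relation symbols.  No bound is put on the number of symbols.\<close>

record ('f, 'r) language =
  fun_syms :: "'f set"
  fun_arity :: "'f \<Rightarrow> nat"
  rel_syms :: "'r set"
  rel_arity :: "'r \<Rightarrow> nat"

text \<open>The universe of a structure is the whole type \<open>'a\<close>.  Interpretations are only meaningful
  for symbols of the language and argument lists of the right length; nothing below depends on
  other values.\<close>

record ('f, 'r, 'a) struct =
  fun_interp :: "'f \<Rightarrow> 'a list \<Rightarrow> 'a"
  rel_interp :: "'r \<Rightarrow> 'a list \<Rightarrow> bool"

datatype 'f tm = Var nat | App 'f "'f tm list"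

datatype ('f, 'r) fm =
    Eq "'f tm" "'f tm"
  | Rel 'r "'f tm list"
  | Neg "('f, 'r) fm"
  | Conj "('f, 'r) fm" "('f, 'r) fm"
  | Exists nat "('f, 'r) fm"

fun wf_tm :: "('f, 'r) language \<Rightarrow> 'f tm \<Rightarrow> bool" where
  "wf_tm L (Var n) \<longleftrightarrow> True"
| "wf_tm L (App f ts) \<longleftrightarrow>
     f \<in> fun_syms L \<and> length ts = fun_arity L f \<and> (\<forall>t\<in>set ts. wf_tm L t)"

fun wf_fm :: "('f, 'r) language \<Rightarrow> ('f, 'r) fm \<Rightarrow> bool" where
  "wf_fm L (Eq s t) \<longleftrightarrow> wf_tm L s \<and> wf_tm L t"
| "wf_fm L (Rel r ts) \<longleftrightarrow>
     r \<in> rel_syms L \<and> length ts = rel_arity L r \<and> (\<forall>t\<in>set ts. wf_tm L t)"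
| "wf_fm L (Neg \<phi>) \<longleftrightarrow> wf_fm L \<phi>"
| "wf_fm L (Conj \<phi> \<psi>) \<longleftrightarrow> wf_fm L \<phi> \<and> wf_fm L \<psi>"
| "wf_fm L (Exists n \<phi>) \<longleftrightarrow> wf_fm L \<phi>"

fun fv_tm :: "'f tm \<Rightarrow> nat set" where
  "fv_tm (Var n) = {n}"
| "fv_tm (App f ts) = (\<Union>t\<in>set ts. fv_tm t)"

fun fv_fm :: "('f, 'r) fm \<Rightarrow> nat set" where
  "fv_fm (Eq s t) = fv_tm s \<union> fv_tm t"
| "fv_fm (Rel r ts) = (\<Union>t\<in>set ts. fv_tm t)"
| "fv_fm (Neg \<phi>) = fv_fm \<phi>"
| "fv_fm (Conj \<phi> \<psi>) = fv_fm \<phi> \<union> fv_fm \<psi>"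
| "fv_fm (Exists n \<phi>) = fv_fm \<phi> - {n}"

fun eval_tm :: "('f, 'r, 'a) struct \<Rightarrow> (nat \<Rightarrow> 'a) \<Rightarrow> 'f tm \<Rightarrow> 'a" where
  "eval_tm M e (Var n) = e n"
| "eval_tm M e (App f ts) = fun_interp M f (map (eval_tm M e) ts)"

fun sat :: "('f, 'r, 'a) struct \<Rightarrow> (nat \<Rightarrow> 'a) \<Rightarrow> ('f, 'r) fm \<Rightarrow> bool" where
  "sat M e (Eq s t) \<longleftrightarrow> eval_tm M e s = eval_tm M e t"
| "sat M e (Rel r ts) \<longleftrightarrow> rel_interp M r (map (eval_tm M e) ts)"
| "sat M e (Neg \<phi>) \<longleftrightarrow> \<not> sat M e \<phi>"
| "sat M e (Conj \<phi> \<psi>) \<longleftrightarrow> sat M e \<phi> \<and> sat M e \<psi>"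
| "sat M e (Exists n \<phi>) \<longleftrightarrow> (\<exists>a. sat M (e(n := a)) \<phi>)"

definition automorphisms :: "('f, 'r) language \<Rightarrow> ('f, 'r, 'a) struct \<Rightarrow> ('a \<Rightarrow> 'a) set" where
  "automorphisms L M = {g. bij g \<and>
     (\<forall>f\<in>fun_syms L. \<forall>xs. length xs = fun_arity L f \<longrightarrow>
        g (fun_interp M f xs) = fun_interp M f (map g xs)) \<and>
     (\<forall>r\<in>rel_syms L. \<forall>xs. length xs = rel_arity L r \<longrightarrow>
        rel_interp M r (map g xs) = rel_interp M r xs)}"

section \<open>Saturation\<close>

text \<open>The language \<open>L(A)\<close>: a constant symbol \<open>Inr a\<close>, naming \<open>a\<close>, is added for each \<open>a \<in> A\<close>.\<close>

definition lang_params :: "('f, 'r) language \<Rightarrow> 'a set \<Rightarrow> ('f + 'a, 'r) language" where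
  "lang_params L A =
     \<lparr>fun_syms = Inl ` fun_syms L \<union> Inr ` A,
      fun_arity = case_sum (fun_arity L) (\<lambda>_. 0),
      rel_syms = rel_syms L,
      rel_arity = rel_arity L\<rparr>"

definition struct_params :: "('f, 'r, 'a) struct \<Rightarrow> ('f + 'a, 'r, 'a) struct" where
  "struct_params M =
     \<lparr>fun_interp = case_sum (fun_interp M) (\<lambda>a _. a),
      rel_interp = rel_interp M\<rparr>"

definition formulas_over ::
    "('f, 'r) language \<Rightarrow> 'a set \<Rightarrow> ('f + 'a, 'r) fm set" where
  "formulas_over L A = {\<phi>. wf_fm (lang_params L A) \<phi> \<and> fv_fm \<phi> \<subseteq> {0}}"

text \<open>Since at most the variable \<open>0\<close> is free, a constant valuation serves to assign \<open>b\<close> to it.\<close>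

definition realises :: "('f, 'r, 'a) struct \<Rightarrow> 'a \<Rightarrow> ('f + 'a, 'r) fm set \<Rightarrow> bool" where
  "realises M b p \<longleftrightarrow> (\<forall>\<phi>\<in>p. sat (struct_params M) (\<lambda>_. b) \<phi>)"

text \<open>Types are (possibly incomplete) sets of formulas in one variable, with fewer parameters than
  the structure has elements, that are finitely satisfiable in the structure.\<close>

definition saturated :: "('f, 'r) language \<Rightarrow> ('f, 'r, 'a) struct \<Rightarrow> bool" where
  "saturated L M \<longleftrightarrow>
     (\<forall>A p. A \<prec> (UNIV :: 'a set) \<and> p \<subseteq> formulas_over L A \<and>
        (\<forall>q\<subseteq>p. finite q \<longrightarrow> (\<exists>b. realises M b q)) \<longrightarrow> (\<exists>b. realises M b p))"

section \<open>Algebraic closure and algebraic independence\<close>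

definition pointwise_stabiliser :: "('a \<Rightarrow> 'a) set \<Rightarrow> 'a set \<Rightarrow> ('a \<Rightarrow> 'a) set" where
  "pointwise_stabiliser G B = {g \<in> G. \<forall>b\<in>B. g b = b}"

definition acl :: "('a \<Rightarrow> 'a) set \<Rightarrow> 'a set \<Rightarrow> 'a set" where
  "acl G B = {x. finite ((\<lambda>g. g x) ` pointwise_stabiliser G B)}"

definition locally_finite_acl :: "('a \<Rightarrow> 'a) set \<Rightarrow> bool" where
  "locally_finite_acl G \<longleftrightarrow> (\<forall>B. finite B \<longrightarrow> finite (acl G B))"

text \<open>\<open>alg_indep G A C B\<close> says that \<open>A\<close> and \<open>B\<close> are independent over the middle set \<open>C\<close>.\<close>

definition alg_indep :: "('a \<Rightarrow> 'a) set \<Rightarrow> 'a set \<Rightarrow> 'a set \<Rightarrow> 'a set \<Rightarrow> bool" where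
  "alg_indep G A C B \<longleftrightarrow> acl G (A \<union> C) \<inter> acl G (B \<union> C) = acl G C"

definition base_monotone :: "('a \<Rightarrow> 'a) set \<Rightarrow> bool" where
  "base_monotone G \<longleftrightarrow>
     (\<forall>A B C D. finite A \<and> finite D \<and> B \<subseteq> C \<and> C \<subseteq> D \<and> alg_indep G A B D
        \<longrightarrow> alg_indep G A C D)"

section \<open>Topologies on transformation semigroups\<close>

definition pointwise_topology :: "('a \<Rightarrow> 'a) topology" where
  "pointwise_topology = product_topology (\<lambda>_. discrete_topology UNIV) UNIV"

text \<open>Continuity into \<open>T\<close> includes that \<open>S\<close> is closed under composition.\<close>

definition Hausdorff_semigroup_topology :: "('a \<Rightarrow> 'a) set \<Rightarrow> ('a \<Rightarrow> 'a) topology \<Rightarrow> bool" where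
  "Hausdorff_semigroup_topology S T \<longleftrightarrow>
     topspace T = S \<and> Hausdorff_space T \<and>
     continuous_map (prod_topology T T) T (\<lambda>(f, g). f \<circ> g)"

definition strictly_coarser :: "'b topology \<Rightarrow> 'b topology \<Rightarrow> bool" where
  "strictly_coarser T' T \<longleftrightarrow> (\<forall>U. openin T' U \<longrightarrow> openin T U) \<and> T' \<noteq> T"

definition minimal_Hausdorff_semigroup_topology ::
    "('a \<Rightarrow> 'a) set \<Rightarrow> ('a \<Rightarrow> 'a) topology \<Rightarrow> bool" where
  "minimal_Hausdorff_semigroup_topology S T \<longleftrightarrow>
     Hausdorff_semigroup_topology S T \<and>
     \<not> (\<exists>T'. Hausdorff_semigroup_topology S T' \<and> strictly_coarser T' T)"

end

theory Submission
  imports Defs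
begin

text \<open>Suppose that a Hausdorff semigroup topology \<open>T\<close> on the closure of \<open>G\<close> is coarser than pointwise
  convergence, and that \<open>s \<longlongrightarrow> s\<^sub>0\<close> in \<open>T\<close> without \<open>s a\<^sub>0 = s\<^sub>0 a\<^sub>0\<close> eventually.  Along a suitable
  refinement, each \<open>s x\<close> is eventually constant, with value \<open>\<sigma> x\<close>, if \<open>x\<close> lies in a closed set \<open>V\<close>,
  and leaves every finite set otherwise.  If \<open>V\<close> is everything, then \<open>s \<longlongrightarrow> \<sigma>\<close> pointwise, so also in
  \<open>T\<close>; hence \<open>\<sigma> = s\<^sub>0\<close> as \<open>T\<close> is Hausdorff, a contradiction.

  It suffices that \<open>s\<^sub>0\<close> maps the range of each embedding \<open>c\<close> into \<open>\<sigma> ` (V \<inter> range c)\<close>: applied to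
  two embeddings whose ranges meet exactly in the finite set \<open>acl {a}\<close>, this shows by counting that
  \<open>acl {a} \<subseteq> V\<close>.  If \<open>b = s\<^sub>0 (c x)\<close> is not in the closed set \<open>D = \<sigma> ` (V \<inter> range c)\<close>, one
  constructs embeddings \<open>g\<close> and \<open>h\<close> with \<open>g b \<noteq> h b\<close> that are so generic that in all neighbourhoods of
  \<open>g\<close>, \<open>h\<close>, \<open>s\<^sub>0\<close> and \<open>c\<close> there are \<open>p\<close>, \<open>p'\<close>, \<open>s\<close> and \<open>c'\<close> with \<open>p \<circ> s \<circ> c' = p' \<circ> s \<circ> c'\<close>.  By
  continuity of composition, \<open>g \<circ> s\<^sub>0 \<circ> c\<close> and \<open>h \<circ> s\<^sub>0 \<circ> c\<close> then cannot be separated in \<open>T\<close>.  Base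
  monotonicity, which is the modular law for finite closed sets, keeps \<open>b\<close> away from the growing set
  on which \<open>g\<close> and \<open>h\<close> have to agree.  Saturation is needed to realise the limit of a family of types
  by a pair of embeddings.\<close>

text \<open>The value at \<open>x\<close> is read off at the first stage whose domain contains
  \<open>x\<close>; by \<open>agree\<close> no later stage changes it. All step-by-step
  constructions below take their limits in this way.\<close>

lemma chain_limit:
  fixes f :: "nat \<Rightarrow> 'b \<Rightarrow> 'c" and D :: "nat \<Rightarrow> 'b set"
  assumes mono: "\<And>k. D k \<subseteq> D (Suc k)"
    and agree: "\<And>k x. x \<in> D k \<Longrightarrow> f (Suc k) x = f k x"
    and exhaust: "(\<Union>k. D k) = UNIV"
  obtains h where "\<And>k x. x \<in> D k \<Longrightarrow> h x = f k x"
proof -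
  have incl: "D k \<subseteq> D (k + j)" for k j
    by (induction j) (use mono in auto)
  have later: "f (k + j) x = f k x" if "x \<in> D k" for k j x
  proof (induction j)
    case (Suc j)
    have "x \<in> D (k + j)" using incl that by blast
    then show ?case using agree Suc by simp
  qed simp
  have "f (LEAST k. x \<in> D k) x = f k x" if "x \<in> D k" for k x
  proof -
    have "(LEAST k. x \<in> D k) \<le> k" "x \<in> D (LEAST k. x \<in> D k)"
      using that by (auto intro: Least_le LeastI)
    then show ?thesis using later by (metis le_add_diff_inverse)
  qed
  then show thesis using that[of "\<lambda>x. f (LEAST k. x \<in> D k) x"] by blast
qed

section \<open>Consequences of saturation\<close>

lemma eval_tm_cong: "(\<And>i. i \<in> fv_tm t \<Longrightarrow> e i = e' i) \<Longrightarrow> eval_tm M e t = eval_tm M e' t"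
proof (induction t)
  case (App f ts)
  then have "map (eval_tm M e) ts = map (eval_tm M e') ts" by (auto intro!: map_cong)
  then show ?case by (simp only: eval_tm.simps)
qed simp

lemma sat_cong: "(\<And>i. i \<in> fv_fm \<phi> \<Longrightarrow> e i = e' i) \<Longrightarrow> sat M e \<phi> \<longleftrightarrow> sat M e' \<phi>"
proof (induction \<phi> arbitrary: e e')
  case (Eq s t)
  have "eval_tm M e s = eval_tm M e' s" "eval_tm M e t = eval_tm M e' t"
    by (rule eval_tm_cong, use Eq.prems in simp)+
  then show ?case by simp
next
  case (Rel r ts)
  have "eval_tm M e t = eval_tm M e' t" if "t \<in> set ts" for t
    by (rule eval_tm_cong) (use Rel.prems that in auto)
  then have "map (eval_tm M e) ts = map (eval_tm M e') ts" by simp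
  then show ?case by (simp only: sat.simps)
next
  case (Neg \<phi>)
  have "sat M e \<phi> = sat M e' \<phi>" by (rule Neg.IH) (use Neg.prems in simp)
  then show ?case by simp
next
  case (Conj \<phi> \<psi>)
  have "sat M e \<phi> = sat M e' \<phi>" by (rule Conj.IH(1)) (use Conj.prems in simp)
  moreover have "sat M e \<psi> = sat M e' \<psi>" by (rule Conj.IH(2)) (use Conj.prems in simp)
  ultimately show ?case by simp
next
  case (Exists n \<phi>)
  have "sat M (e(n := a)) \<phi> = sat M (e'(n := a)) \<phi>" for a
    by (rule Exists.IH) (use Exists.prems in auto)
  then show ?case by simp
qed

lemma finite_fv_tm: "finite (fv_tm t)"
  by (induction t) auto

lemma finite_fv_fm: "finite (fv_fm \<phi>)"
  by (induction \<phi>) (auto simp: finite_fv_tm)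

section \<open>Replacing variables by constants for parameters\<close>

fun subst_tm :: "(nat \<Rightarrow> ('f + 'a) tm) \<Rightarrow> 'f tm \<Rightarrow> ('f + 'a) tm" where
  "subst_tm \<sigma> (Var n) = \<sigma> n"
| "subst_tm \<sigma> (App f ts) = App (Inl f) (map (subst_tm \<sigma>) ts)"

text \<open>The bound variable \<open>n\<close> is renamed to \<open>Suc n\<close>, which keeps \<open>0\<close> free and avoids capture as
  long as \<open>\<sigma> i\<close> contains no variables except \<open>0\<close> and \<open>Suc i\<close>.\<close>

fun subst_fm :: "(nat \<Rightarrow> ('f + 'a) tm) \<Rightarrow> ('f, 'r) fm \<Rightarrow> ('f + 'a, 'r) fm" where
  "subst_fm \<sigma> (Eq s t) = Eq (subst_tm \<sigma> s) (subst_tm \<sigma> t)"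
| "subst_fm \<sigma> (Rel r ts) = Rel r (map (subst_tm \<sigma>) ts)"
| "subst_fm \<sigma> (Neg \<phi>) = Neg (subst_fm \<sigma> \<phi>)"
| "subst_fm \<sigma> (Conj \<phi> \<psi>) = Conj (subst_fm \<sigma> \<phi>) (subst_fm \<sigma> \<psi>)"
| "subst_fm \<sigma> (Exists n \<phi>) = Exists (Suc n) (subst_fm (\<sigma>(n := Var (Suc n))) \<phi>)"

lemma eval_subst_tm:
  "eval_tm (struct_params M) e (subst_tm \<sigma> t) = eval_tm M (\<lambda>i. eval_tm (struct_params M) e (\<sigma> i)) t"
proof (induction t)
  case (App f ts)
  then have "map (eval_tm (struct_params M) e \<circ> subst_tm \<sigma>) ts =
    map (eval_tm M (\<lambda>i. eval_tm (struct_params M) e (\<sigma> i))) ts"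
    by (auto intro!: map_cong)
  then have "fun_interp M f (map (eval_tm (struct_params M) e \<circ> subst_tm \<sigma>) ts) =
    fun_interp M f (map (eval_tm M (\<lambda>i. eval_tm (struct_params M) e (\<sigma> i))) ts)" by (rule arg_cong)
  moreover have "fun_interp (struct_params M) (Inl f) xs = fun_interp M f xs" for xs
    by (simp add: struct_params_def)
  ultimately show ?case by simp
qed simp

lemma sat_subst_fm:
  assumes "\<And>i. fv_tm (\<sigma> i) \<subseteq> {0, Suc i}"
  shows "sat (struct_params M) e (subst_fm \<sigma> \<phi>) \<longleftrightarrow>
    sat M (\<lambda>i. eval_tm (struct_params M) e (\<sigma> i)) \<phi>"
  using assms
proof (induction \<phi> arbitrary: e \<sigma>)
  case (Eq s t)
  then show ?case by (simp add: eval_subst_tm)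
next
  case (Rel r ts)
  have "map (eval_tm (struct_params M) e \<circ> subst_tm \<sigma>) ts =
    map (eval_tm M (\<lambda>i. eval_tm (struct_params M) e (\<sigma> i))) ts"
    by (auto simp: eval_subst_tm)
  moreover have "rel_interp (struct_params M) r xs = rel_interp M r xs" for xs
    by (simp add: struct_params_def)
  ultimately show ?case by (simp only: subst_fm.simps sat.simps map_map)
next
  case (Exists n \<phi>)
  \<comment> \<open>Among the terms assigned by \<sigma>, only \<open>\<sigma> n\<close> could
    mention the variable \<open>Suc n\<close>, and it has just been overwritten.\<close>
  have "(\<lambda>i. eval_tm (struct_params M) (e(Suc n := a)) ((\<sigma>(n := Var (Suc n))) i)) =
      (\<lambda>i. eval_tm (struct_params M) e (\<sigma> i))(n := a)" for a
  proof
    fix i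
    show "eval_tm (struct_params M) (e(Suc n := a)) ((\<sigma>(n := Var (Suc n))) i) =
      ((\<lambda>i. eval_tm (struct_params M) e (\<sigma> i))(n := a)) i"
    proof (cases "i = n")
      case False
      then show ?thesis using Exists.prems[of i]
        by (auto intro!: eval_tm_cong)
    qed simp
  qed
  moreover have "fv_tm ((\<sigma>(n := Var (Suc n))) i) \<subseteq> {0, Suc i}" for i
    using Exists.prems by simp
  ultimately show ?case using Exists.IH[of "\<sigma>(n := Var (Suc n))"]
    by (simp del: fun_upd_apply)
qed simp_all

lemma wf_subst_tm:
  "wf_tm L t \<Longrightarrow> (\<And>i. i \<in> fv_tm t \<Longrightarrow> wf_tm (lang_params L A) (\<sigma> i)) \<Longrightarrow>
    wf_tm (lang_params L A) (subst_tm \<sigma> t)"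
  by (induction t) (auto simp: lang_params_def)

lemma wf_subst_fm:
  "wf_fm L \<phi> \<Longrightarrow> (\<And>i. i \<in> fv_fm \<phi> \<Longrightarrow> wf_tm (lang_params L A) (\<sigma> i)) \<Longrightarrow>
    wf_fm (lang_params L A) (subst_fm \<sigma> \<phi>)"
proof (induction \<phi> arbitrary: \<sigma>)
  case (Rel r ts)
  then have "wf_tm (lang_params L A) (subst_tm \<sigma> t)" if "t \<in> set ts" for t
    using that by (intro wf_subst_tm) auto
  then show ?case using Rel.prems by (auto simp: lang_params_def)
next
  case (Exists n \<phi>)
  then show ?case by (auto intro!: Exists.IH)
qed (auto intro: wf_subst_tm)

lemma fv_subst_tm: "fv_tm (subst_tm \<sigma> t) = (\<Union>i\<in>fv_tm t. fv_tm (\<sigma> i))"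
  by (induction t) auto

lemma fv_subst_fm: "fv_fm (subst_fm \<sigma> \<phi>) \<subseteq> (\<Union>i\<in>fv_fm \<phi>. fv_tm (\<sigma> i))"
proof (induction \<phi> arbitrary: \<sigma>)
  case (Conj \<phi> \<psi>)
  show ?case using Conj.IH[of \<sigma>] by auto
next
  case (Exists n \<phi>)
  show ?case
  proof
    fix x assume x: "x \<in> fv_fm (subst_fm \<sigma> (Exists n \<phi>))"
    then have "x \<in> fv_fm (subst_fm (\<sigma>(n := Var (Suc n))) \<phi>)" by simp
    then obtain i where i: "i \<in> fv_fm \<phi>" "x \<in> fv_tm ((\<sigma>(n := Var (Suc n))) i)"
      using Exists.IH[of "\<sigma>(n := Var (Suc n))"] by blast
    moreover have "i \<noteq> n" using i(2) x by auto
    ultimately show "x \<in> (\<Union>i\<in>fv_fm (Exists n \<phi>). fv_tm (\<sigma> i))" by auto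
  qed
qed (auto simp: fv_subst_tm)

text \<open>Naming the values of \<open>w\<close> on \<open>I\<close> by constants and renaming
  \<open>n\<close> to \<open>0\<close> turns \<Phi> into a type over the finite set of these values,
  to which saturation applies.\<close>

lemma saturated_realise_variable:
  fixes M :: "('f, 'r, 'a) struct" and w :: "nat \<Rightarrow> 'a"
  assumes sat: "saturated L M" and inf: "infinite (UNIV :: 'a set)"
    and "finite I" and n: "n \<notin> I"
    and \<Phi>: "\<And>\<phi>. \<phi> \<in> \<Phi> \<Longrightarrow> wf_fm L \<phi> \<and> fv_fm \<phi> \<subseteq> insert n I"
    and fin: "\<And>\<Psi>. finite \<Psi> \<Longrightarrow> \<Psi> \<subseteq> \<Phi> \<Longrightarrow> \<exists>z. \<forall>\<phi>\<in>\<Psi>. sat M (w(n := z)) \<phi>"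
  shows "\<exists>z. \<forall>\<phi>\<in>\<Phi>. sat M (w(n := z)) \<phi>"
proof -
  \<comment> \<open>Off \<open>I\<close>, only \<open>n\<close> can occur free in \<Phi>, so the
    value at any other variable is an arbitrary default.\<close>
  define \<sigma> :: "nat \<Rightarrow> ('f + 'a) tm" where
    "\<sigma> = (\<lambda>i. if i \<in> I then App (Inr (w i)) [] else Var 0)"
  let ?A = "w ` I"
  have \<sigma>: "sat (struct_params M) (\<lambda>_. z) (subst_fm \<sigma> \<phi>) \<longleftrightarrow> sat M (w(n := z)) \<phi>"
    if "\<phi> \<in> \<Phi>" for z \<phi>
  proof -
    have "sat (struct_params M) (\<lambda>_. z) (subst_fm \<sigma> \<phi>) \<longleftrightarrow>
        sat M (\<lambda>i. eval_tm (struct_params M) (\<lambda>_. z) (\<sigma> i)) \<phi>"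
      by (rule sat_subst_fm) (auto simp: \<sigma>_def)
    also have "\<dots> \<longleftrightarrow> sat M (w(n := z)) \<phi>"
      using \<Phi>[OF that] n by (intro sat_cong) (auto simp: \<sigma>_def struct_params_def)
    finally show ?thesis .
  qed
  have "?A \<prec> (UNIV :: 'a set)"
    using \<open>finite I\<close> inf by (simp add: finite_lesspoll_infinite)
  moreover have "subst_fm \<sigma> ` \<Phi> \<subseteq> formulas_over L ?A"
  proof
    fix \<psi> assume "\<psi> \<in> subst_fm \<sigma> ` \<Phi>"
    then obtain \<phi> where \<phi>: "\<phi> \<in> \<Phi>" "\<psi> = subst_fm \<sigma> \<phi>" by blast
    have "wf_fm (lang_params L ?A) \<psi>"
      unfolding \<phi> using \<Phi>[OF \<phi>(1)] by (intro wf_subst_fm) (auto simp: \<sigma>_def lang_params_def)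
    moreover have "fv_fm \<psi> \<subseteq> {0}"
      unfolding \<phi> using fv_subst_fm[of \<sigma> \<phi>] by (auto simp: \<sigma>_def split: if_splits)
    ultimately show "\<psi> \<in> formulas_over L ?A" by (simp add: formulas_over_def)
  qed
  moreover have "\<exists>z. realises M z q" if q: "q \<subseteq> subst_fm \<sigma> ` \<Phi>" "finite q" for q
  proof -
    obtain \<Psi> where \<Psi>: "\<Psi> \<subseteq> \<Phi>" "finite \<Psi>" "q = subst_fm \<sigma> ` \<Psi>"
      using finite_subset_image[OF q(2,1)] by blast
    then obtain z where "\<forall>\<phi>\<in>\<Psi>. sat M (w(n := z)) \<phi>" using fin by blast
    then have "realises M z q" using \<sigma> \<Psi> by (auto simp: realises_def)
    then show ?thesis ..
  qed
  ultimately have "\<exists>z. realises M z (subst_fm \<sigma> ` \<Phi>)"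
    using sat unfolding saturated_def by blast
  then show ?thesis using \<sigma> by (auto simp: realises_def)
qed

lemma conjunction_exists:
  assumes "finite \<Psi>" and "\<And>\<phi>. \<phi> \<in> \<Psi> \<Longrightarrow> wf_fm L \<phi> \<and> fv_fm \<phi> \<subseteq> insert n I"
  shows "\<exists>\<theta>. wf_fm L \<theta> \<and> fv_fm \<theta> \<subseteq> insert n I \<and> (\<forall>e. sat M e \<theta> \<longleftrightarrow> (\<forall>\<phi>\<in>\<Psi>. sat M e \<phi>))"
  using assms
proof (induction \<Psi>)
  case empty
  \<comment> \<open>Formulas have no truth constant; this valid equation serves as the empty
    conjunction.\<close>
  show ?case by (rule exI[of _ "Eq (Var n) (Var n)"]) simp
next
  case (insert \<phi> \<Psi>)
  then obtain \<theta> where "wf_fm L \<theta>" "fv_fm \<theta> \<subseteq> Set.insert n I"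
    "\<forall>e. sat M e \<theta> \<longleftrightarrow> (\<forall>\<phi>\<in>\<Psi>. sat M e \<phi>)" by auto
  then show ?case using insert.prems by (intro exI[of _ "Conj \<phi> \<theta>"]) auto
qed

section \<open>Realising limits of types\<close>

text \<open>On the variables in \<open>I\<close>, the assignment \<open>w\<close> satisfies the limit along \<open>F\<close> of the types of
  the assignments \<open>v k\<close>.\<close>

definition limit_type ::
    "('f, 'r) language \<Rightarrow> ('f, 'r, 'a) struct \<Rightarrow> 'k filter \<Rightarrow> ('k \<Rightarrow> nat \<Rightarrow> 'a) \<Rightarrow>
      nat set \<Rightarrow> (nat \<Rightarrow> 'a) \<Rightarrow> bool" where
  "limit_type L M F v I w \<longleftrightarrow>
     (\<forall>\<phi>. wf_fm L \<phi> \<and> fv_fm \<phi> \<subseteq> I \<and> (\<forall>\<^sub>F k in F. sat M (v k) \<phi>) \<longrightarrow> sat M w \<phi>)"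

text \<open>Finitely many formulas that hold eventually hold together eventually. Hence their
  conjunction, quantified over \<open>n\<close>, holds eventually with witness \<open>v k n\<close>,
  and being a formula over \<open>I\<close> it passes to \<open>w\<close>. This is finite
  satisfiability, and saturation does the rest.\<close>

lemma limit_type_step:
  fixes M :: "('f, 'r, 'a) struct" and w :: "nat \<Rightarrow> 'a"
  assumes sat: "saturated L M" and inf: "infinite (UNIV :: 'a set)"
    and "finite I" and n: "n \<notin> I" and lim: "limit_type L M F v I w"
  shows "\<exists>z. limit_type L M F v (insert n I) (w(n := z))"
proof -
  let ?\<Phi> = "{\<phi>. wf_fm L \<phi> \<and> fv_fm \<phi> \<subseteq> insert n I \<and> (\<forall>\<^sub>F k in F. sat M (v k) \<phi>)}"
  have "\<exists>z. \<forall>\<phi>\<in>?\<Phi>. sat M (w(n := z)) \<phi>"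
  proof (rule saturated_realise_variable[OF sat inf \<open>finite I\<close> n])
    fix \<Psi> assume \<Psi>: "finite \<Psi>" "\<Psi> \<subseteq> ?\<Phi>"
    obtain \<theta> where \<theta>: "wf_fm L \<theta>" "fv_fm \<theta> \<subseteq> insert n I"
        "\<And>e. sat M e \<theta> \<longleftrightarrow> (\<forall>\<phi>\<in>\<Psi>. sat M e \<phi>)"
      using conjunction_exists[of \<Psi> L n I M] \<Psi> by blast
    have "\<forall>\<^sub>F k in F. \<forall>\<phi>\<in>\<Psi>. sat M (v k) \<phi>"
      using \<Psi> by (intro eventually_ball_finite) auto
    then have "\<forall>\<^sub>F k in F. sat M (v k) (Exists n \<theta>)"
    proof (eventually_elim)
      case (elim k)
      then have "sat M ((v k)(n := v k n)) \<theta>" using \<theta>(3) by simp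
      then show ?case by (auto simp del: fun_upd_triv)
    qed
    moreover have "wf_fm L (Exists n \<theta>)" "fv_fm (Exists n \<theta>) \<subseteq> I" using \<theta>(1,2) by auto
    ultimately have "sat M w (Exists n \<theta>)" using lim unfolding limit_type_def by blast
    then show "\<exists>z. \<forall>\<phi>\<in>\<Psi>. sat M (w(n := z)) \<phi>" using \<theta>(3) by simp
  qed auto
  then show ?thesis unfolding limit_type_def by blast
qed

lemma limit_type_realised:
  fixes M :: "('f, 'r, 'a) struct"
  assumes sat: "saturated L M" and inf: "infinite (UNIV :: 'a set)" and F: "F \<noteq> bot"
  shows "\<exists>w. limit_type L M F v UNIV w"
proof -
  have "\<exists>f. \<forall>n. limit_type L M F v {..<n} (f n) \<and> (\<forall>i<n. f (Suc n) i = f n i)"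
  proof (rule dependent_nat_choice)
    \<comment> \<open>At stage \<open>0\<close> only sentences occur. Their truth does not depend on
      the assignment, and \<open>F \<noteq> bot\<close> provides some \<open>k\<close> at which the
      sentence holds.\<close>
    have "sat M undefined \<phi>" if \<phi>: "fv_fm \<phi> \<subseteq> {..<0}" "\<forall>\<^sub>F k in F. sat M (v k) \<phi>" for \<phi>
    proof -
      obtain k where "sat M (v k) \<phi>"
        using eventually_happens'[OF F \<phi>(2)] by blast
      then show ?thesis using sat_cong[of \<phi> "v k" undefined M] \<phi>(1) by auto
    qed
    then show "\<exists>w. limit_type L M F v {..<0} w" unfolding limit_type_def by blast
  next
    fix w n assume "limit_type L M F v {..<n} w"
    then obtain z where "limit_type L M F v (insert n {..<n}) (w(n := z))"
      using limit_type_step[OF sat inf, of "{..<n}" n F v w] by auto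
    then show "\<exists>w'. limit_type L M F v {..<Suc n} w' \<and> (\<forall>i<n. w' i = w i)"
      by (intro exI[of _ "w(n := z)"]) (auto simp: lessThan_Suc)
  qed
  then obtain f where f: "\<And>n. limit_type L M F v {..<n} (f n)" "\<And>n i. i < n \<Longrightarrow> f (Suc n) i = f n i"
    by blast
  obtain w where w: "\<And>n i. i \<in> {..<n} \<Longrightarrow> w i = f n i"
  proof (rule chain_limit[of "\<lambda>n. {..<n}" f])
    have "i \<in> {..<Suc i}" for i by simp
    then show "(\<Union>n. {..<n}) = (UNIV :: nat set)" by blast
  qed (use f(2) in auto)
  have "sat M w \<phi>" if \<phi>: "wf_fm L \<phi>" "\<forall>\<^sub>F k in F. sat M (v k) \<phi>" for \<phi>
  proof -
    obtain n where "fv_fm \<phi> \<subseteq> {..<n}" using finite_nat_iff_bounded finite_fv_fm by blast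
    moreover from this have "sat M (f n) \<phi>" using f(1)[of n] \<phi> by (simp add: limit_type_def)
    moreover have "sat M w \<phi> \<longleftrightarrow> sat M (f n) \<phi>" using calculation(1) w by (intro sat_cong) auto
    ultimately show ?thesis by simp
  qed
  then show ?thesis unfolding limit_type_def by blast
qed

section \<open>Back and forth between tuples of the same type\<close>

definition same_type ::
    "('f, 'r) language \<Rightarrow> ('f, 'r, 'a) struct \<Rightarrow> nat set \<Rightarrow> (nat \<Rightarrow> 'a) \<Rightarrow> (nat \<Rightarrow> 'a) \<Rightarrow> bool" where
  "same_type L M I u w \<longleftrightarrow>
     (\<forall>\<phi>. wf_fm L \<phi> \<and> fv_fm \<phi> \<subseteq> I \<longrightarrow> (sat M u \<phi> \<longleftrightarrow> sat M w \<phi>))"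

lemma same_type_sym: "same_type L M I u w \<Longrightarrow> same_type L M I w u"
  by (simp add: same_type_def)

lemma same_type_cong:
  assumes "\<And>i. i \<in> I \<Longrightarrow> u i = u' i" "\<And>i. i \<in> I \<Longrightarrow> w i = w' i"
  shows "same_type L M I u w \<longleftrightarrow> same_type L M I u' w'"
proof -
  have "sat M u \<phi> = sat M u' \<phi>" "sat M w \<phi> = sat M w' \<phi>" if "fv_fm \<phi> \<subseteq> I" for \<phi>
    using that assms by (auto intro!: sat_cong)
  then show ?thesis unfolding same_type_def by auto
qed

text \<open>A constant family converges to its own type, and negation turns the one-sided condition
  into an equivalence. Extension of limit types thus yields extension of tuples of the same
  type.\<close>

lemma same_type_iff_limit_type:
  "same_type L M I u w \<longleftrightarrow> limit_type L M (principal (UNIV :: unit set)) (\<lambda>_. u) I w"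
proof
  assume lim: "limit_type L M (principal (UNIV :: unit set)) (\<lambda>_. u) I w"
  have imp: "sat M w \<phi>" if "wf_fm L \<phi>" "fv_fm \<phi> \<subseteq> I" "sat M u \<phi>" for \<phi>
    using lim that unfolding limit_type_def by simp
  have "sat M u \<phi> \<longleftrightarrow> sat M w \<phi>" if "wf_fm L \<phi>" "fv_fm \<phi> \<subseteq> I" for \<phi>
    using imp[of \<phi>] imp[of "Neg \<phi>"] that by auto
  then show "same_type L M I u w" by (simp add: same_type_def)
qed (auto simp: same_type_def limit_type_def eventually_principal)

lemma same_type_extend:
  fixes M :: "('f, 'r, 'a) struct"
  assumes sat: "saturated L M" and inf: "infinite (UNIV :: 'a set)"
    and "finite I" and n: "n \<notin> I" and "same_type L M I u w"
  shows "\<exists>z. same_type L M (insert n I) (u(n := x)) (w(n := z))"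
proof -
  have "same_type L M I (u(n := x)) w"
    using assms(5) by (rule same_type_cong[THEN iffD1, rotated 2]) (use n in auto)
  then show ?thesis
    using limit_type_step[OF sat inf \<open>finite I\<close> n] by (simp add: same_type_iff_limit_type)
qed

lemma same_type_fill:
  fixes M :: "('f, 'r, 'a) struct"
  assumes sat: "saturated L M" and inf: "infinite (UNIV :: 'a set)"
    and "finite I" and "finite J" and "same_type L M I u w"
  shows "\<exists>w'. same_type L M (I \<union> J) u w' \<and> (\<forall>i\<in>I. w' i = w i)"
  using \<open>finite J\<close>
proof (induction J)
  case empty
  then show ?case using assms(5) by auto
next
  case (insert n J)
  then obtain w' where w': "same_type L M (I \<union> J) u w'" "\<forall>i\<in>I. w' i = w i" by blast
  show ?case
  proof (cases "n \<in> I")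
    case True
    then show ?thesis using w' by (auto simp: insert_absorb)
  next
    case False
    then obtain z where "same_type L M (Set.insert n (I \<union> J)) (u(n := u n)) (w'(n := z))"
      using same_type_extend[OF sat inf _ _ w'(1), of n "u n"] \<open>finite I\<close> insert.hyps by auto
    then show ?thesis using False w'(2) by (intro exI[of _ "w'(n := z)"]) (simp del: fun_upd_apply, simp)
  qed
qed

text \<open>Both assignments enumerate the universe, possibly with repetitions. Equations between
  variables make the matching well defined and injective; the other atomic formulas make it respect
  the symbols.\<close>

lemma same_type_imp_automorphism:
  fixes M :: "('f, 'r, 'a) struct"
  assumes same: "same_type L M UNIV u w" and u: "range u = UNIV" and w: "range w = UNIV"
  shows "\<exists>g\<in>automorphisms L M. \<forall>i. g (u i) = w i"
proof -
  have eq: "u i = u j \<longleftrightarrow> w i = w j" for i j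
    using same[unfolded same_type_def, rule_format, of "Eq (Var i) (Var j)"] by simp
  define g where "g = (\<lambda>x. w (SOME i. u i = x))"
  have g: "g (u i) = w i" for i
    unfolding g_def using eq by (metis (mono_tags) someI)
  have "bij g"
  proof (rule bijI)
    show "inj g"
    proof (rule injI)
      fix x y assume "g x = g y"
      moreover obtain i j where "u i = x" "u j = y" using u by (metis UNIV_I rangeE)
      ultimately show "x = y" using g eq by metis
    qed
    have "range w \<subseteq> range g" using g by (metis image_subsetI rangeI)
    then show "surj g" using w by auto
  qed
  moreover have "g (fun_interp M f xs) = fun_interp M f (map g xs)"
    if "f \<in> fun_syms L" "length xs = fun_arity L f" for f xs
  proof -
    obtain js where js: "xs = map u js" using u by (metis ex_map_conv UNIV_I rangeE)
    obtain j where j: "u j = fun_interp M f xs" using u by (metis UNIV_I rangeE)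
    have "sat M u (Eq (App f (map Var js)) (Var j)) \<longleftrightarrow> sat M w (Eq (App f (map Var js)) (Var j))"
      using same[unfolded same_type_def, rule_format, of "Eq (App f (map Var js)) (Var j)"] that js
      by simp
    moreover have "map g xs = map w js" "map (eval_tm M e \<circ> Var) js = map e js" for e
      using js g by auto
    moreover have "g (fun_interp M f xs) = w j" using g[of j] j by simp
    moreover have "fun_interp M f (map u js) = u j" using j js by simp
    ultimately show ?thesis by simp
  qed
  moreover have "rel_interp M r (map g xs) = rel_interp M r xs"
    if "r \<in> rel_syms L" "length xs = rel_arity L r" for r xs
  proof -
    obtain js where js: "xs = map u js" using u by (metis ex_map_conv UNIV_I rangeE)
    have "sat M u (Rel r (map Var js)) \<longleftrightarrow> sat M w (Rel r (map Var js))"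
      using same[unfolded same_type_def, rule_format, of "Rel r (map Var js)"] that js
      by simp
    moreover have "map g xs = map w js" "map (eval_tm M e \<circ> Var) js = map e js" for e
      using js g by auto
    ultimately have "rel_interp M r (map g xs) = rel_interp M r (map u js)" by simp
    then show ?thesis using js by simp
  qed
  ultimately have "g \<in> automorphisms L M" by (auto simp: automorphisms_def)
  then show ?thesis using g by blast
qed

text \<open>A back-and-forth construction: each stage puts the next element of the universe into the
  range of both assignments, and the limits satisfy
  \<open>same_type_imp_automorphism\<close>.\<close>

lemma saturated_homogeneous:
  fixes M :: "('f, 'r, 'a) struct"
  assumes sat: "saturated L M" and inf: "infinite (UNIV :: 'a set)"
    and count: "countable (UNIV :: 'a set)"
    and "finite I" and same: "same_type L M I u w"
  shows "\<exists>g\<in>automorphisms L M. \<forall>i\<in>I. g (u i) = w i"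
proof -
  \<comment> \<open>Padding \<open>I\<close> to an initial segment leaves the indices
    \<open>N + 2 * n\<close> and \<open>Suc (N + 2 * n)\<close> fresh at stage
    \<open>n\<close>.\<close>
  obtain N where N: "I \<subseteq> {..<N}" using \<open>finite I\<close> finite_nat_iff_bounded by blast
  obtain w0 where w0: "same_type L M {..<N} u w0" "\<forall>i\<in>I. w0 i = w i"
    using same_type_fill[OF sat inf \<open>finite I\<close> _ same, of "{..<N}"] N by (auto simp: Un_absorb1)
  define \<nu> :: "nat \<Rightarrow> 'a" where "\<nu> = from_nat_into UNIV"
  have \<nu>: "range \<nu> = UNIV" unfolding \<nu>_def using count by (simp add: range_from_nat_into)
  let ?P = "\<lambda>n p. same_type L M {..<N + 2 * n} (fst p) (snd p) \<and>
    (\<forall>i<N. fst p i = u i \<and> snd p i = w0 i)"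
  let ?Q = "\<lambda>n p q. (\<forall>i<N + 2 * n. fst q i = fst p i \<and> snd q i = snd p i) \<and>
    fst q (N + 2 * n) = \<nu> n \<and> snd q (Suc (N + 2 * n)) = \<nu> n"
  have "\<exists>f. \<forall>n. ?P n (f n) \<and> ?Q n (f n) (f (Suc n))"
  proof (rule dependent_nat_choice)
    show "\<exists>x. ?P 0 x" using w0(1) by (intro exI[of _ "(u, w0)"]) simp
  next
    fix x n assume "?P n x"
    then obtain u1 w1 where x: "x = (u1, w1)" and
      same1: "same_type L M {..<N + 2 * n} u1 w1" "\<forall>i<N. u1 i = u i \<and> w1 i = w0 i" by (cases x) auto
    let ?k = "N + 2 * n"
    have fin: "finite {..<?k}" "?k \<notin> {..<?k}" by auto
    obtain z where z: "same_type L M (insert ?k {..<?k}) (u1(?k := \<nu> n)) (w1(?k := z))"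
      using same_type_extend[OF sat inf fin same1(1)] by blast
    let ?u = "u1(?k := \<nu> n)" and ?w = "w1(?k := z)"
    \<comment> \<open>The back step is the forth step with the two assignments exchanged.\<close>
    obtain y where "same_type L M (insert (Suc ?k) {..<Suc ?k}) (?w(Suc ?k := \<nu> n)) (?u(Suc ?k := y))"
      using same_type_extend[OF sat inf _ _ same_type_sym[OF z[folded lessThan_Suc]], of "Suc ?k"]
      by auto
    moreover have "insert (Suc ?k) {..<Suc ?k} = {..<N + 2 * Suc n}" by auto
    ultimately have "same_type L M {..<N + 2 * Suc n} (?u(Suc ?k := y)) (?w(Suc ?k := \<nu> n))"
      using same_type_sym by metis
    then have "?P (Suc n) (?u(Suc ?k := y), ?w(Suc ?k := \<nu> n)) \<and>
        ?Q n x (?u(Suc ?k := y), ?w(Suc ?k := \<nu> n))"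
      using same1 x by auto
    then show "\<exists>y. ?P (Suc n) y \<and> ?Q n x y" by blast
  qed
  then obtain f where P: "\<And>n. ?P n (f n)" and Q: "\<And>n. ?Q n (f n) (f (Suc n))" by blast
  define fu fw where "fu = (\<lambda>n. fst (f n))" and "fw = (\<lambda>n. snd (f n))"
  have agree: "fu (Suc n) i = fu n i" "fw (Suc n) i = fw n i" if "i \<in> {..<N + 2 * n}" for n i
    using Q[of n] that by (simp_all add: fu_def fw_def)
  have new: "fu (Suc n) (N + 2 * n) = \<nu> n" "fw (Suc n) (Suc (N + 2 * n)) = \<nu> n" for n
    using Q[of n] by (simp_all add: fu_def fw_def)
  have same_f: "same_type L M {..<N + 2 * n} (fu n) (fw n)" for n
    using P[of n] by (simp add: fu_def fw_def)
  have start: "fu 0 i = u i" "fw 0 i = w0 i" if "i < N" for i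
    using P[of 0] that by (simp_all add: fu_def fw_def)
  have grow: "{..<N + 2 * n} \<subseteq> {..<N + 2 * Suc n}" for n by auto
  have exh: "(\<Union>n. {..<N + 2 * n}) = UNIV"
  proof -
    have "i \<in> {..<N + 2 * Suc i}" for i by simp
    then show ?thesis by blast
  qed
  obtain U where U: "\<And>n i. i \<in> {..<N + 2 * n} \<Longrightarrow> U i = fu n i"
    using chain_limit[of "\<lambda>n. {..<N + 2 * n}" fu, OF grow agree(1) exh] by blast
  obtain W where W: "\<And>n i. i \<in> {..<N + 2 * n} \<Longrightarrow> W i = fw n i"
    using chain_limit[of "\<lambda>n. {..<N + 2 * n}" fw, OF grow agree(2) exh] by blast
  have "same_type L M UNIV U W" unfolding same_type_def
  proof (intro allI impI)
    fix \<phi> assume \<phi>: "wf_fm L \<phi> \<and> fv_fm \<phi> \<subseteq> UNIV"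
    obtain n where n: "fv_fm \<phi> \<subseteq> {..<n}" using finite_nat_iff_bounded finite_fv_fm by blast
    then have sub: "fv_fm \<phi> \<subseteq> {..<N + 2 * n}" by auto
    have "same_type L M {..<N + 2 * n} U W"
      using same_f[of n] by (rule same_type_cong[THEN iffD1, rotated 2]) (simp_all add: U W)
    then show "sat M U \<phi> \<longleftrightarrow> sat M W \<phi>" using \<phi> sub by (auto simp: same_type_def)
  qed
  moreover have "range U = UNIV"
  proof -
    have "U (N + 2 * n) = \<nu> n" for n
      using U[of "N + 2 * n" "Suc n"] new by simp
    then show ?thesis using \<nu> by (metis UNIV_eq_I rangeE rangeI)
  qed
  moreover have "range W = UNIV"
  proof -
    have "W (Suc (N + 2 * n)) = \<nu> n" for n
      using W[of "Suc (N + 2 * n)" "Suc n"] new by simp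
    then show ?thesis using \<nu> by (metis UNIV_eq_I rangeE rangeI)
  qed
  ultimately obtain g where g: "g \<in> automorphisms L M" "\<And>i. g (U i) = W i"
    using same_type_imp_automorphism by blast
  have "g (u i) = w i" if "i \<in> I" for i
  proof -
    have "i < N" using that N by blast
    then show ?thesis using g(2)[of i] U[of i 0] W[of i 0] start w0(2) that by simp
  qed
  then show ?thesis using g(1) by blast
qed

section \<open>Automorphisms and their pointwise closure\<close>

definition pointwise_closure :: "('a \<Rightarrow> 'a) set \<Rightarrow> ('a \<Rightarrow> 'a) set" where
  "pointwise_closure G = {s. \<forall>F. finite F \<longrightarrow> (\<exists>g\<in>G. \<forall>x\<in>F. g x = s x)}"

lemma automorphism_fun:
  "g \<in> automorphisms L M \<Longrightarrow> f \<in> fun_syms L \<Longrightarrow> length xs = fun_arity L f \<Longrightarrow>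
    g (fun_interp M f xs) = fun_interp M f (map g xs)"
  unfolding automorphisms_def by blast

lemma automorphism_rel:
  "g \<in> automorphisms L M \<Longrightarrow> r \<in> rel_syms L \<Longrightarrow> length xs = rel_arity L r \<Longrightarrow>
    rel_interp M r (map g xs) = rel_interp M r xs"
  unfolding automorphisms_def by blast

lemma automorphism_bij: "g \<in> automorphisms L M \<Longrightarrow> bij g"
  unfolding automorphisms_def by blast

lemma automorphism_eval_tm:
  assumes g: "g \<in> automorphisms L M"
  shows "wf_tm L t \<Longrightarrow> eval_tm M (g \<circ> e) t = g (eval_tm M e t)"
proof (induction t)
  case (App f ts)
  then have "map (eval_tm M (g \<circ> e)) ts = map g (map (eval_tm M e) ts)"
    by (auto simp del: comp_apply simp: comp_apply[of g "eval_tm M e"])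
  moreover have "fun_interp M f (map g (map (eval_tm M e) ts)) = g (fun_interp M f (map (eval_tm M e) ts))"
    using automorphism_fun[OF g, of f] App.prems by simp
  ultimately show ?case by (simp only: eval_tm.simps)
qed simp

lemma automorphism_sat:
  assumes g: "g \<in> automorphisms L M"
  shows "wf_fm L \<phi> \<Longrightarrow> sat M (g \<circ> e) \<phi> \<longleftrightarrow> sat M e \<phi>"
proof (induction \<phi> arbitrary: e)
  case (Eq s t)
  have "inj g" using automorphism_bij[OF g] by (simp add: bij_def)
  moreover have "eval_tm M (g \<circ> e) s = g (eval_tm M e s)" "eval_tm M (g \<circ> e) t = g (eval_tm M e t)"
    using Eq automorphism_eval_tm[OF g] by (simp_all del: comp_apply)
  ultimately show ?case by (simp add: inj_eq del: comp_apply)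
next
  case (Rel r ts)
  then have "map (eval_tm M (g \<circ> e)) ts = map g (map (eval_tm M e) ts)"
    using automorphism_eval_tm[OF g] by (auto simp del: comp_apply simp: comp_apply[of g "eval_tm M e"])
  moreover have "rel_interp M r (map g (map (eval_tm M e) ts)) = rel_interp M r (map (eval_tm M e) ts)"
    by (rule automorphism_rel[OF g]) (use Rel.prems in auto)
  ultimately show ?case by (simp only: sat.simps)
next
  case (Exists n \<phi>)
  have upd: "(g \<circ> e)(n := g a) = g \<circ> e(n := a)" for a by auto
  have "surj g" using automorphism_bij[OF g] by (simp add: bij_def)
  then have "(\<exists>a. sat M ((g \<circ> e)(n := a)) \<phi>) \<longleftrightarrow> (\<exists>a. sat M ((g \<circ> e)(n := g a)) \<phi>)"
    by (auto simp del: fun_upd_apply) (metis surj_f_inv_f)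
  moreover have "sat M (g \<circ> e') \<phi> \<longleftrightarrow> sat M e' \<phi>" for e'
    using Exists.IH Exists.prems by (simp del: comp_apply)
  ultimately show ?case by (simp only: sat.simps upd)
qed simp_all

text \<open>Each finite part of the constraints holds for a pair (\<open>id\<close>,
  \<open>k\<close>) with \<open>k\<close> an automorphism, and (\<open>m\<close>, \<open>m'\<close>)
  realises a limit of the types of these pairs. As automorphisms preserve types, \<open>m\<close>
  and \<open>m'\<close> each have the type of the identity, so homogeneity puts both into the
  closure.\<close>

lemma saturated_pair_of_embeddings:
  fixes M :: "('f, 'r, 'a) struct"
  assumes sat: "saturated L M" and inf: "infinite (UNIV :: 'a set)"
    and count: "countable (UNIV :: 'a set)"
    and fin: "\<And>E N. finite E \<Longrightarrow> finite N \<Longrightarrow> E \<subseteq> P \<Longrightarrow> N \<subseteq> R \<Longrightarrow>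
      \<exists>k\<in>automorphisms L M. (\<forall>(x, y)\<in>E. k x = y) \<and> (\<forall>(x, y)\<in>N. k x \<noteq> y)"
  shows "\<exists>m\<in>pointwise_closure (automorphisms L M). \<exists>m'\<in>pointwise_closure (automorphisms L M).
    (\<forall>(x, y)\<in>P. m' x = m y) \<and> (\<forall>(x, y)\<in>R. m' x \<noteq> m y)"
proof -
  let ?G = "automorphisms L M"
  define \<nu> :: "nat \<Rightarrow> 'a" where "\<nu> = from_nat_into UNIV"
  define \<iota> :: "'a \<Rightarrow> nat" where "\<iota> = to_nat_on UNIV"
  have \<nu>\<iota>: "\<nu> (\<iota> x) = x" for x unfolding \<nu>_def \<iota>_def using count by simp
  \<comment> \<open>\<open>B\<close> indexes the finite parts of the constraints, \<open>C\<close>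
    gives their solutions, and \<open>F\<close> is the filter generated by the solution
    sets.\<close>
  define B where "B = {(E, N). finite E \<and> finite N \<and> E \<subseteq> P \<and> N \<subseteq> R}"
  define C where "C = (\<lambda>(E, N). {k \<in> ?G. (\<forall>(x, y)\<in>E. k x = y) \<and> (\<forall>(x, y)\<in>N. k x \<noteq> y)})"
  define F where "F = (INF p\<in>B. principal (C p))"
  have ev: "eventually Q F \<longleftrightarrow> (\<exists>p\<in>B. \<forall>k\<in>C p. Q k)" for Q
  proof -
    have "eventually Q F \<longleftrightarrow> (\<exists>p\<in>B. eventually Q (principal (C p)))"
      unfolding F_def
    proof (rule eventually_INF_base)
      show "B \<noteq> {}" by (auto simp: B_def)
      fix p q assume pq: "p \<in> B" "q \<in> B"
      have "(fst p \<union> fst q, snd p \<union> snd q) \<in> B" using pq by (auto simp: B_def)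
      moreover have "C (fst p \<union> fst q, snd p \<union> snd q) \<subseteq> C p \<inter> C q"
        by (cases p; cases q) (fastforce simp: C_def)
      ultimately show "\<exists>x\<in>B. principal (C x) \<le> inf (principal (C p)) (principal (C q))" by auto
    qed
    then show ?thesis by (simp add: eventually_principal)
  qed
  have F: "F \<noteq> bot"
  proof
    assume "F = bot"
    then have "eventually (\<lambda>_. False) F" by simp
    then obtain E N where "(E, N) \<in> B" "C (E, N) = {}" unfolding ev by auto
    then show False using fin[of E N] by (auto simp: B_def C_def)
  qed
  have ev_G: "\<forall>\<^sub>F k in F. k \<in> ?G"
    unfolding ev by (rule bexI[of _ "({}, {})"]) (auto simp: B_def C_def)
  \<comment> \<open>Even variables carry the elements of the universe, odd variables their images
    under \<open>k\<close>.\<close>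
  define v where "v = (\<lambda>k i. if even i then \<nu> (i div 2) else k (\<nu> (i div 2)))"
  obtain w where w: "limit_type L M F v UNIV w"
    using limit_type_realised[OF sat inf F] by blast
  have lim: "sat M w \<phi>" if "\<forall>\<^sub>F k in F. sat M (v k) \<phi>" "wf_fm L \<phi>" for \<phi>
    using w that by (simp add: limit_type_def)
  have same: "same_type L M I u w"
    if u: "\<And>\<phi>. wf_fm L \<phi> \<Longrightarrow> fv_fm \<phi> \<subseteq> I \<Longrightarrow> \<forall>\<^sub>F k in F. sat M (v k) \<phi> \<longleftrightarrow> sat M u \<phi>" for I u
  proof -
    have imp: "sat M w \<phi>" if \<phi>: "wf_fm L \<phi>" "fv_fm \<phi> \<subseteq> I" "sat M u \<phi>" for \<phi>
    proof -
      have "\<forall>\<^sub>F k in F. sat M (v k) \<phi>" using u[OF \<phi>(1,2)] \<phi>(3) by simp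
      then show ?thesis using \<phi>(1) by (rule lim)
    qed
    have "sat M u \<phi> \<longleftrightarrow> sat M w \<phi>" if "wf_fm L \<phi>" "fv_fm \<phi> \<subseteq> I" for \<phi>
      using imp[of \<phi>] imp[of "Neg \<phi>"] that by auto
    then show ?thesis by (simp add: same_type_def)
  qed
  define m m' where "m = (\<lambda>x. w (2 * \<iota> x))" and "m' = (\<lambda>x. w (2 * \<iota> x + 1))"
  have "m \<in> pointwise_closure ?G"
    unfolding pointwise_closure_def
  proof (safe)
    fix X :: "'a set" assume X: "finite X"
    let ?I = "(\<lambda>x. 2 * \<iota> x) ` X"
    have "same_type L M ?I (\<lambda>i. \<nu> (i div 2)) w"
    proof (rule same)
      fix \<phi> :: "('f, 'r) fm" assume "fv_fm \<phi> \<subseteq> ?I"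
      then have "sat M (v k) \<phi> \<longleftrightarrow> sat M (\<lambda>i. \<nu> (i div 2)) \<phi>" for k
        by (intro sat_cong) (auto simp: v_def)
      then show "\<forall>\<^sub>F k in F. sat M (v k) \<phi> \<longleftrightarrow> sat M (\<lambda>i. \<nu> (i div 2)) \<phi>" by simp
    qed
    then obtain g where "g \<in> ?G" "\<forall>i\<in>?I. g (\<nu> (i div 2)) = w i"
      using saturated_homogeneous[OF sat inf count] X by blast
    then show "\<exists>g\<in>?G. \<forall>x\<in>X. g x = m x" by (auto simp: m_def \<nu>\<iota>)
  qed
  moreover have "m' \<in> pointwise_closure ?G"
    unfolding pointwise_closure_def
  proof (safe)
    fix X :: "'a set" assume X: "finite X"
    let ?I = "(\<lambda>x. 2 * \<iota> x + 1) ` X"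
    have "same_type L M ?I (\<lambda>i. \<nu> (i div 2)) w"
    proof (rule same)
      fix \<phi> :: "('f, 'r) fm" assume \<phi>: "wf_fm L \<phi>" "fv_fm \<phi> \<subseteq> ?I"
      have "sat M (v k) \<phi> \<longleftrightarrow> sat M (k \<circ> (\<lambda>i. \<nu> (i div 2))) \<phi>" for k
        using \<phi>(2) by (intro sat_cong) (auto simp: v_def)
      then show "\<forall>\<^sub>F k in F. sat M (v k) \<phi> \<longleftrightarrow> sat M (\<lambda>i. \<nu> (i div 2)) \<phi>"
        using automorphism_sat[OF _ \<phi>(1)] by (intro eventually_mono[OF ev_G]) simp
    qed
    then obtain g where "g \<in> ?G" "\<forall>i\<in>?I. g (\<nu> (i div 2)) = w i"
      using saturated_homogeneous[OF sat inf count] X by blast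
    then show "\<exists>g\<in>?G. \<forall>x\<in>X. g x = m' x" by (auto simp: m'_def \<nu>\<iota>)
  qed
  moreover have "m' x = m y" if "(x, y) \<in> P" for x y
  proof -
    have "\<forall>\<^sub>F k in F. sat M (v k) (Eq (Var (2 * \<iota> x + 1)) (Var (2 * \<iota> y)))"
      unfolding ev using that
      by (intro bexI[of _ "({(x, y)}, {})"]) (auto simp: B_def C_def v_def \<nu>\<iota>)
    then have "sat M w (Eq (Var (2 * \<iota> x + 1)) (Var (2 * \<iota> y)))"
      by (rule lim) simp
    then show ?thesis by (simp add: m_def m'_def)
  qed
  moreover have "m' x \<noteq> m y" if "(x, y) \<in> R" for x y
  proof -
    have "\<forall>\<^sub>F k in F. sat M (v k) (Neg (Eq (Var (2 * \<iota> x + 1)) (Var (2 * \<iota> y))))"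
      unfolding ev using that
      by (intro bexI[of _ "({}, {(x, y)})"]) (auto simp: B_def C_def v_def \<nu>\<iota>)
    then have "sat M w (Neg (Eq (Var (2 * \<iota> x + 1)) (Var (2 * \<iota> y))))"
      by (rule lim) simp
    then show ?thesis by (simp add: m_def m'_def)
  qed
  ultimately show ?thesis by blast
qed

lemma automorphism_group:
  "id \<in> automorphisms L M"
  "g \<in> automorphisms L M \<Longrightarrow> h \<in> automorphisms L M \<Longrightarrow> g \<circ> h \<in> automorphisms L M"
  "g \<in> automorphisms L M \<Longrightarrow> inv g \<in> automorphisms L M"
proof -
  show "id \<in> automorphisms L M" by (simp add: automorphisms_def)
  show "g \<circ> h \<in> automorphisms L M" if "g \<in> automorphisms L M" "h \<in> automorphisms L M"
  proof -
    have "map (g \<circ> h) xs = map g (map h xs)" for xs by simp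
    then show ?thesis using that unfolding automorphisms_def
      by (auto intro: bij_comp simp del: map_map)
  qed
  show "inv g \<in> automorphisms L M" if g: "g \<in> automorphisms L M"
  proof -
    have b: "bij g" using g by (rule automorphism_bij)
    have id: "map g (map (inv g) xs) = xs" for xs
      using b by (simp add: bij_is_surj surj_f_inv_f comp_def)
    have "inv g (fun_interp M f xs) = fun_interp M f (map (inv g) xs)"
      if "f \<in> fun_syms L" "length xs = fun_arity L f" for f xs
    proof -
      have "g (fun_interp M f (map (inv g) xs)) = fun_interp M f (map g (map (inv g) xs))"
        using automorphism_fun[OF g that(1)] that(2) by simp
      then show ?thesis using b unfolding id by (metis bij_inv_eq_iff)
    qed
    moreover have "rel_interp M r (map (inv g) xs) = rel_interp M r xs"
      if "r \<in> rel_syms L" "length xs = rel_arity L r" for r xs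
    proof -
      have "rel_interp M r (map g (map (inv g) xs)) = rel_interp M r (map (inv g) xs)"
        by (rule automorphism_rel[OF g that(1)]) (use that(2) in simp)
      then show ?thesis unfolding id by simp
    qed
    ultimately show ?thesis using b by (simp add: automorphisms_def bij_imp_bij_inv)
  qed
qed

section \<open>Permutation groups with modular algebraic closure\<close>

text \<open>The last assumption is the trace of saturation that the topological argument uses.\<close>

locale modular_perm_group =
  fixes G :: "('a \<Rightarrow> 'a) set"
  assumes bij: "g \<in> G \<Longrightarrow> bij g"
    and id_mem: "id \<in> G"
    and comp_mem: "g \<in> G \<Longrightarrow> h \<in> G \<Longrightarrow> g \<circ> h \<in> G"
    and inv_mem: "g \<in> G \<Longrightarrow> inv g \<in> G"
    and countable_UNIV: "countable (UNIV :: 'a set)"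
    and finite_acl: "finite B \<Longrightarrow> finite (acl G B)"
    and base_monotone: "base_monotone G"
    and pair_of_embeddings:
      "(\<And>E N. finite E \<Longrightarrow> finite N \<Longrightarrow> E \<subseteq> P \<Longrightarrow> N \<subseteq> R \<Longrightarrow>
          \<exists>k\<in>G. (\<forall>(x, y)\<in>E. k x = y) \<and> (\<forall>(x, y)\<in>N. k x \<noteq> y)) \<Longrightarrow>
        \<exists>m\<in>pointwise_closure G. \<exists>m'\<in>pointwise_closure G.
          (\<forall>(x, y)\<in>P. m' x = m y) \<and> (\<forall>(x, y)\<in>R. m' x \<noteq> m y)"
begin

section \<open>Algebraic closure as a closure operator\<close>

abbreviation cl :: "'a set \<Rightarrow> 'a set" where "cl \<equiv> acl G"

abbreviation S :: "('a \<Rightarrow> 'a) set" where "S \<equiv> pointwise_closure G"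

text \<open>Testing finite subsets makes the notion usable for infinite sets such as ranges of
  embeddings. For finite sets it means being a fixed point of \<open>cl\<close>, by
  \<open>alg_closed_finite\<close>.\<close>

definition alg_closed :: "'a set \<Rightarrow> bool" where
  "alg_closed D \<longleftrightarrow> (\<forall>F. finite F \<longrightarrow> F \<subseteq> D \<longrightarrow> cl F \<subseteq> D)"

lemma inj: "g \<in> G \<Longrightarrow> inj g"
  using bij by (simp add: bij_is_inj)

lemma inv_apply [simp]: "g \<in> G \<Longrightarrow> inv g (g x) = x" "g \<in> G \<Longrightarrow> g (inv g x) = x"
  using bij by (simp_all add: bij_is_inj bij_is_surj surj_f_inv_f)

lemma subset_acl: "B \<subseteq> cl B"
proof
  fix x assume "x \<in> B"
  then have "(\<lambda>g. g x) ` pointwise_stabiliser G B \<subseteq> {x}" by (auto simp: pointwise_stabiliser_def)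
  then show "x \<in> cl B" unfolding acl_def using finite_subset by blast
qed

lemma acl_mono: "A \<subseteq> B \<Longrightarrow> cl A \<subseteq> cl B"
proof
  fix x assume "A \<subseteq> B" "x \<in> cl A"
  then have "(\<lambda>g. g x) ` pointwise_stabiliser G B \<subseteq> (\<lambda>g. g x) ` pointwise_stabiliser G A"
    by (auto simp: pointwise_stabiliser_def)
  then show "x \<in> cl B" using \<open>x \<in> cl A\<close> unfolding acl_def by (blast intro: finite_subset)
qed

text \<open>Conjugation by \<open>g\<close> carries the stabiliser of the image of \<open>B\<close>
  into the stabiliser of \<open>B\<close>, so the orbits correspond.\<close>

lemma image_acl_subset: "g \<in> G \<Longrightarrow> g ` cl B \<subseteq> cl (g ` B)"
proof
  fix y assume g: "g \<in> G" and "y \<in> g ` cl B"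
  then obtain x where x: "x \<in> cl B" "y = g x" by blast
  have "(\<lambda>h. h y) ` pointwise_stabiliser G (g ` B) \<subseteq> g ` (\<lambda>h. h x) ` pointwise_stabiliser G B"
  proof
    fix z assume "z \<in> (\<lambda>h. h y) ` pointwise_stabiliser G (g ` B)"
    then obtain h where h: "h \<in> G" "\<forall>b\<in>B. h (g b) = g b" "z = h y"
      by (auto simp: pointwise_stabiliser_def)
    have "inv g \<circ> (h \<circ> g) \<in> pointwise_stabiliser G B"
      using g h by (auto simp: pointwise_stabiliser_def intro!: comp_mem inv_mem)
    moreover have "z = g ((inv g \<circ> (h \<circ> g)) x)" using g h x by simp
    ultimately show "z \<in> g ` (\<lambda>h. h x) ` pointwise_stabiliser G B" by blast
  qed
  then have "finite ((\<lambda>h. h y) ` pointwise_stabiliser G (g ` B))"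
    using x(1) by (elim finite_subset) (simp add: acl_def)
  then show "y \<in> cl (g ` B)" by (simp add: acl_def)
qed

lemma acl_image: assumes g: "g \<in> G" shows "cl (g ` B) = g ` cl B"
proof
  have "inv g ` cl (g ` B) \<subseteq> cl (inv g ` g ` B)" using image_acl_subset inv_mem g by blast
  then have "g ` inv g ` cl (g ` B) \<subseteq> g ` cl (inv g ` g ` B)" by blast
  then show "cl (g ` B) \<subseteq> g ` cl B" using g by (simp add: image_image)
qed (rule image_acl_subset[OF g])

text \<open>The stabiliser of \<open>B\<close> maps the finite set \<open>cl B\<close> into itself,
  so only finitely many restrictions to it occur. Elements with equal restriction differ by an
  element fixing \<open>cl B\<close> pointwise, under which \<open>x\<close> has a finite
  orbit.\<close>

lemma acl_acl:
  assumes "finite B" shows "cl (cl B) = cl B"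
proof
  show "cl (cl B) \<subseteq> cl B"
  proof
    fix x assume "x \<in> cl (cl B)"
    let ?C = "cl B"
    let ?H = "pointwise_stabiliser G B"
    let ?orb = "(\<lambda>g. g x) ` pointwise_stabiliser G ?C"
    have orb: "finite ?orb" using \<open>x \<in> cl (cl B)\<close> by (simp add: acl_def)
    have "g ` ?C \<subseteq> ?C" if "g \<in> ?H" for g
    proof -
      have "g \<in> G" "g ` B = B" using that by (auto simp: pointwise_stabiliser_def)
      then show ?thesis using acl_image[of g B] by simp
    qed
    then have "(\<lambda>g. restrict g ?C) ` ?H \<subseteq> ?C \<rightarrow>\<^sub>E ?C" by fastforce
    then have fin: "finite ((\<lambda>g. restrict g ?C) ` ?H)"
      using finite_PiE[of ?C "\<lambda>_. ?C"] finite_acl[OF assms] finite_subset by blast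
    \<comment> \<open>\<open>r\<close> picks one group element for each restriction, as a coset
      representative.\<close>
    define r where "r = (\<lambda>\<rho>. SOME g. g \<in> ?H \<and> restrict g ?C = \<rho>)"
    have r: "r (restrict g ?C) \<in> ?H \<and> restrict (r (restrict g ?C)) ?C = restrict g ?C"
      if "g \<in> ?H" for g
      unfolding r_def by (rule someI[of _ g]) (use that in simp)
    have "(\<lambda>g. g x) ` ?H \<subseteq> (\<Union>\<rho>\<in>(\<lambda>g. restrict g ?C) ` ?H. r \<rho> ` ?orb)"
    proof
      fix y assume "y \<in> (\<lambda>g. g x) ` ?H"
      then obtain g where g: "g \<in> ?H" "y = g x" by blast
      let ?h = "r (restrict g ?C)"
      have mem: "?h \<in> G" "g \<in> G" using r[OF g(1)] g(1) by (simp_all add: pointwise_stabiliser_def)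
      have "?h c = g c" if "c \<in> ?C" for c using conjunct2[OF r[OF g(1)]] that by (metis restrict_apply')
      then have "inv ?h (g c) = c" if "c \<in> ?C" for c
        using inv_apply(1)[OF mem(1), of c] that by simp
      then have "inv ?h \<circ> g \<in> pointwise_stabiliser G ?C"
        using comp_mem[OF inv_mem[OF mem(1)] mem(2)] by (simp add: pointwise_stabiliser_def)
      moreover have "y = ?h ((inv ?h \<circ> g) x)" using g mem by simp
      ultimately show "y \<in> (\<Union>\<rho>\<in>(\<lambda>g. restrict g ?C) ` ?H. r \<rho> ` ?orb)" using g(1) by blast
    qed
    moreover have "finite (\<Union>\<rho>\<in>(\<lambda>g. restrict g ?C) ` ?H. r \<rho> ` ?orb)" using fin orb by blast
    ultimately show "x \<in> cl B" unfolding acl_def using finite_subset by blast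
  qed
qed (rule subset_acl)

lemma acl_subset: "finite B \<Longrightarrow> A \<subseteq> cl B \<Longrightarrow> cl A \<subseteq> cl B"
  using acl_mono acl_acl by blast

lemma alg_closed_finite: "finite X \<Longrightarrow> alg_closed X \<longleftrightarrow> cl X = X"
  unfolding alg_closed_def using subset_acl acl_mono by blast

lemma acl_Int:
  assumes "finite X" "cl X = X" "alg_closed D" shows "cl (X \<inter> D) = X \<inter> D"
proof -
  have "cl (X \<inter> D) \<subseteq> X" using assms acl_mono[of "X \<inter> D" X] by auto
  moreover have "cl (X \<inter> D) \<subseteq> D" using assms unfolding alg_closed_def by auto
  ultimately show ?thesis using subset_acl[of "X \<inter> D"] by blast
qed

lemma acl_image_closed: "g \<in> G \<Longrightarrow> cl X = X \<Longrightarrow> cl (g ` X) = g ` X"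
  by (simp add: acl_image)

lemma move_off_finite:
  assumes "x \<notin> cl B" "finite K"
  shows "\<exists>h\<in>G. (\<forall>b\<in>B. h b = b) \<and> h x \<notin> K"
proof -
  have "\<not> (\<lambda>g. g x) ` pointwise_stabiliser G B \<subseteq> K"
    using assms finite_subset unfolding acl_def by blast
  then show ?thesis by (auto simp: pointwise_stabiliser_def)
qed

text \<open>A form of Neumann's lemma.  Local finiteness of \<open>cl\<close> lets one move a minimal closed
  extension of \<open>B\<close> at a time: all its new points are interalgebraic over \<open>B\<close>, so that one of them
  escaping \<open>cl (B \<union> K)\<close> means that all avoid \<open>K\<close>.\<close>

lemma move_closed_off_finite:
  assumes "finite X" "cl X = X" "cl B = B" "B \<subseteq> X" "finite K"
  shows "\<exists>h\<in>G. (\<forall>b\<in>B. h b = b) \<and> h ` X \<inter> K \<subseteq> B"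
  using assms
proof (induction "card (X - B)" arbitrary: X B rule: less_induct)
  case less
  show ?case
  proof (cases "X = B")
    case True
    then show ?thesis using id_mem by (intro bexI[of _ id]) auto
  next
    case False
    then have "\<exists>x. x \<in> X - B" using less.prems by blast
    then obtain x where x: "x \<in> X - B"
      and min: "\<And>y. y \<in> X - B \<Longrightarrow> card (cl (insert x B)) \<le> card (cl (insert y B))"
      using ex_has_least_nat[of "\<lambda>x. x \<in> X - B" _ "\<lambda>x. card (cl (insert x B))"] by metis
    have finB: "finite B" using less.prems finite_subset by blast
    let ?B = "cl (insert x B)" and ?K = "cl (B \<union> K)"
    have fin: "finite ?B" "finite ?K" using finite_acl finB less.prems(5) by (simp_all del: Un_insert_left)
    have sub: "insert x B \<subseteq> ?B" by (rule subset_acl)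
    have BX: "?B \<subseteq> X" using acl_mono[of "insert x B" X] x less.prems by auto
    obtain h where h: "h \<in> G" "\<And>b. b \<in> B \<Longrightarrow> h b = b" "h x \<notin> ?K"
      using move_off_finite[OF _ fin(2), of x B] x less.prems(3) by auto
    \<comment> \<open>By minimality \<open>z\<close> generates all of \<open>?B\<close> over
      \<open>B\<close>, so \<open>h z\<close> in \<open>K\<close> would force \<open>h x\<close>
      into \<open>?K\<close>.\<close>
    have off: "h z \<notin> K" if z: "z \<in> ?B - B" for z
    proof
      assume "h z \<in> K"
      have "cl (insert z B) \<subseteq> ?B" using z sub finB by (intro acl_subset) auto
      moreover have "card ?B \<le> card (cl (insert z B))" using min z BX by blast
      ultimately have "cl (insert z B) = ?B" using fin by (metis card_seteq)
      then have "h x \<in> h ` cl (insert z B)" using sub by auto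
      also have "\<dots> = cl (insert (h z) (h ` B))" using acl_image[OF h(1), of "insert z B"] by simp
      also have "\<dots> \<subseteq> ?K" using h(2) \<open>h z \<in> K\<close> by (intro acl_mono) auto
      finally show False using h(3) by simp
    qed
    \<comment> \<open>The induction continues with the images of \<open>X\<close> and
      \<open>?B\<close> under \<open>h\<close>; fewer points are new because \<open>x\<close> has
      moved into the base.\<close>
    have "h ` X - h ` ?B = h ` (X - ?B)" using inj[OF h(1)] by (simp add: image_set_diff)
    then have "card (h ` X - h ` ?B) = card (X - ?B)"
      using inj[OF h(1)] by (metis card_image inj_on_subset subset_UNIV)
    also have "\<dots> < card (X - B)"
      using x sub BX less.prems by (intro psubset_card_mono) auto
    finally have "card (h ` X - h ` ?B) < card (X - B)" .
    moreover have "cl (h ` X) = h ` X" "cl (h ` ?B) = h ` ?B"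
      using h(1) less.prems acl_image_closed acl_acl finB by auto
    moreover have "finite (h ` X)" "h ` ?B \<subseteq> h ` X" using BX less.prems by auto
    ultimately obtain d where d: "d \<in> G" "\<forall>b\<in>h ` ?B. d b = b" "d ` h ` X \<inter> K \<subseteq> h ` ?B"
      using less.hyps[of "h ` X" "h ` ?B"] less.prems(5) by blast
    have "d \<circ> h \<in> G" using d h comp_mem by blast
    moreover have "(d \<circ> h) b = b" if "b \<in> B" for b
      using that h(2)[of b] d(2) sub by force
    moreover have "(d \<circ> h) ` X \<inter> K \<subseteq> B"
    proof
      fix y assume "y \<in> (d \<circ> h) ` X \<inter> K"
      then have "y \<in> h ` ?B" "y \<in> K" using d(3) by (auto simp: image_comp)
      then obtain z where "z \<in> ?B" "y = h z" by blast
      then show "y \<in> B" using off[of z] h(2)[of z] \<open>y \<in> K\<close> by (metis DiffI)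
    qed
    ultimately show ?thesis by blast
  qed
qed

text \<open>Base monotonicity amounts to the modular law for the lattice of finite closed sets.\<close>

lemma modular_avoid:
  assumes fin: "finite J" "finite K" "finite E" and cl: "cl E = E" "cl K = K"
    and "J \<subseteq> K" "E \<inter> K \<subseteq> cl J" "c \<in> K" "c \<notin> cl J"
  shows "c \<notin> cl (J \<union> E)"
proof -
  let ?J = "cl J"
  have JK: "?J \<subseteq> K" using acl_mono[OF \<open>J \<subseteq> K\<close>] cl by simp
  have "cl (E \<inter> K) = E \<inter> K"
    using acl_Int[of E K] alg_closed_finite fin cl by blast
  \<comment> \<open>This holds for any two closed sets with closed intersection; base monotonicity
    then raises the middle set to \<open>?J\<close>.\<close>
  then have "alg_indep G E (E \<inter> K) K"
    unfolding alg_indep_def using cl by (simp add: Un_absorb2)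
  then have "alg_indep G E ?J K"
    using base_monotone fin JK assms(7) unfolding base_monotone_def by blast
  then have "cl (E \<union> ?J) \<inter> K = ?J"
    unfolding alg_indep_def using cl JK acl_acl[OF fin(1)] by (simp add: Un_absorb2)
  moreover have "cl (J \<union> E) \<subseteq> cl (E \<union> ?J)" using subset_acl[of J] by (intro acl_mono) auto
  ultimately show ?thesis using assms by blast
qed

section \<open>Embeddings in the closure\<close>

lemma closure_memI: "(\<And>F. finite F \<Longrightarrow> \<exists>g\<in>G. \<forall>x\<in>F. g x = s x) \<Longrightarrow> s \<in> S"
  by (simp add: pointwise_closure_def)

lemma closure_approx:
  assumes "s \<in> S" "finite F" obtains g where "g \<in> G" "\<And>x. x \<in> F \<Longrightarrow> g x = s x"
  using assms unfolding pointwise_closure_def by blast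

lemma group_subset_closure: "g \<in> G \<Longrightarrow> g \<in> S"
  by (rule closure_memI) auto

lemma closure_comp: assumes "s \<in> S" "t \<in> S" shows "s \<circ> t \<in> S"
proof (rule closure_memI)
  fix F :: "'a set" assume "finite F"
  obtain h where h: "h \<in> G" "\<And>x. x \<in> F \<Longrightarrow> h x = t x"
    using closure_approx[OF assms(2) \<open>finite F\<close>] by blast
  obtain g where "g \<in> G" "\<And>x. x \<in> t ` F \<Longrightarrow> g x = s x"
    using closure_approx[OF assms(1), of "t ` F"] \<open>finite F\<close> by blast
  then show "\<exists>g\<in>G. \<forall>x\<in>F. g x = (s \<circ> t) x"
    using h comp_mem by (intro bexI[of _ "g \<circ> h"]) auto
qed

lemma closure_inj: assumes "s \<in> S" shows "inj s"
proof (rule injI)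
  fix x y assume "s x = s y"
  obtain g where "g \<in> G" "\<And>z. z \<in> {x, y} \<Longrightarrow> g z = s z"
    using closure_approx[OF assms, of "{x, y}"] by blast
  then show "x = y" using \<open>s x = s y\<close> inj by (metis injD insertCI)
qed

text \<open>On the finite set \<open>cl X\<close>, the embedding \<open>s\<close> agrees with a
  group element.\<close>

lemma acl_closure_image:
  assumes s: "s \<in> S" and X: "finite X" shows "cl (s ` X) = s ` cl X"
proof -
  obtain g where g: "g \<in> G" "\<And>x. x \<in> cl X \<Longrightarrow> g x = s x"
    using closure_approx[OF s finite_acl[OF X]] by blast
  have "s ` X = g ` X" "s ` cl X = g ` cl X"
    using g(2) subset_acl[of X] by (auto simp: image_iff) force+
  then show ?thesis using acl_image[OF g(1)] by simp
qed

lemma alg_closed_range: assumes "s \<in> S" shows "alg_closed (range s)"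
  unfolding alg_closed_def
proof (intro allI impI)
  fix F assume "finite F" "F \<subseteq> range s"
  then obtain X where "finite X" "F = s ` X" using finite_subset_image by metis
  then show "cl F \<subseteq> range s" using acl_closure_image[OF assms] by blast
qed

lemma closure_limit:
  assumes "\<And>k. g k \<in> G" "\<And>k x. x \<in> D k \<Longrightarrow> s x = g k x"
    and "\<And>k. D k \<subseteq> D (Suc k)" "(\<Union>k. D k) = UNIV"
  shows "s \<in> S"
proof (rule closure_memI)
  fix F :: "'a set" assume "finite F"
  have mono: "mono D" using assms(3) by (simp add: mono_iff_le_Suc)
  have "\<exists>k. F \<subseteq> D k" using \<open>finite F\<close>
  proof (induction F)
    case (insert x F)
    then obtain k j where "F \<subseteq> D k" "x \<in> D j" using assms(4) by blast
    then have "Set.insert x F \<subseteq> D (max k j)"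
      using monoD[OF mono, of k "max k j"] monoD[OF mono, of j "max k j"] by auto
    then show ?case ..
  qed simp
  then show "\<exists>g\<in>G. \<forall>x\<in>F. g x = s x" using assms(1,2) by (metis subsetD)
qed

text \<open>A finite part of the requirements involves a finite subset of \<open>Y\<close>, over
  which \<open>b\<close> is not algebraic, so some group element fixes that subset and moves
  \<open>b\<close>.\<close>

lemma embeddings_agreeing_on:
  assumes Y: "\<And>F. finite F \<Longrightarrow> F \<subseteq> Y \<Longrightarrow> b \<notin> cl F"
  obtains m m' where "m \<in> S" "m' \<in> S" "\<And>y. y \<in> Y \<Longrightarrow> m' y = m y" "m' b \<noteq> m b"
proof -
  have "\<exists>m\<in>S. \<exists>m'\<in>S. (\<forall>(x, y)\<in>{(y, y) | y. y \<in> Y}. m' x = m y) \<and> (\<forall>(x, y)\<in>{(b, b)}. m' x \<noteq> m y)"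
  proof (rule pair_of_embeddings)
    fix E N :: "('a \<times> 'a) set"
    assume E: "finite E" "E \<subseteq> {(y, y) | y. y \<in> Y}" and N: "N \<subseteq> {(b, b)}"
    have "b \<notin> cl (fst ` E)" using E by (intro Y) auto
    then obtain k where "k \<in> G" "\<forall>y\<in>fst ` E. k y = y" "k b \<notin> {b}"
      using move_off_finite[of b _ "{b}"] by blast
    then show "\<exists>k\<in>G. (\<forall>(x, y)\<in>E. k x = y) \<and> (\<forall>(x, y)\<in>N. k x \<noteq> y)"
      using E N by (intro bexI[of _ k]) (auto, fastforce)
  qed
  then show thesis using that by fastforce
qed

text \<open>The requirements are that \<open>m'\<close> agrees with \<open>m\<close> on
  \<open>cl B\<close> and takes no value of \<open>m\<close> elsewhere. Finite parts are met by
  group elements that fix \<open>cl B\<close> and move other points away, by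
  \<open>move_closed_off_finite\<close>.\<close>

lemma embeddings_meeting_in_acl:
  assumes "finite B"
  obtains c c' where "c \<in> S" "c' \<in> S" "\<And>x. x \<in> cl B \<Longrightarrow> c x = x" "\<And>x. x \<in> cl B \<Longrightarrow> c' x = x"
    "range c \<inter> range c' \<subseteq> cl B"
proof -
  let ?B = "cl B"
  have "\<exists>m\<in>S. \<exists>m'\<in>S. (\<forall>(x, y)\<in>{(x, x) | x. x \<in> ?B}. m' x = m y) \<and>
      (\<forall>(x, y)\<in>(- ?B) \<times> UNIV. m' x \<noteq> m y)"
  proof (rule pair_of_embeddings)
    fix E N :: "('a \<times> 'a) set"
    assume fin: "finite E" "finite N" and E: "E \<subseteq> {(x, x) | x. x \<in> ?B}" and N: "N \<subseteq> (- ?B) \<times> UNIV"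
    let ?X = "cl (B \<union> fst ` N)"
    have "finite (B \<union> fst ` N)" using fin assms by simp
    moreover have "?B \<subseteq> ?X" by (intro acl_mono) auto
    ultimately obtain k where k: "k \<in> G" "\<forall>b\<in>?B. k b = b" "k ` ?X \<inter> snd ` N \<subseteq> ?B"
      using move_closed_off_finite[of ?X ?B "snd ` N"] finite_acl acl_acl assms fin(2) by force
    have "k x \<noteq> y" if "(x, y) \<in> N" for x y
    proof
      assume "k x = y"
      have "x \<in> ?X" using that subset_acl[of "B \<union> fst ` N"] by force
      then have "k x \<in> ?B" using \<open>k x = y\<close> that k(3) by force
      \<comment> \<open>As \<open>k\<close> fixes \<open>?B\<close> pointwise, it attains a value in
        \<open>?B\<close> only at that value itself.\<close>
      then have "k (k x) = k x" using k(2) by blast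
      then have "k x = x" using inj[OF k(1)] by (metis injD)
      then show False using \<open>k x \<in> ?B\<close> N that by auto
    qed
    then show "\<exists>k\<in>G. (\<forall>(x, y)\<in>E. k x = y) \<and> (\<forall>(x, y)\<in>N. k x \<noteq> y)"
      using E k by (intro bexI[of _ k]) auto
  qed
  then obtain m m' where m: "m \<in> S" "m' \<in> S" "\<And>x. x \<in> ?B \<Longrightarrow> m' x = m x"
    "\<And>x y. x \<notin> ?B \<Longrightarrow> m' x \<noteq> m y" by fast
  \<comment> \<open>\<open>m\<close> and \<open>m'\<close> agree on \<open>?B\<close> but need not
    fix it; composing with \<open>inv g\<close> repairs this.\<close>
  obtain g where g: "g \<in> G" "\<And>x. x \<in> ?B \<Longrightarrow> g x = m x"
    using closure_approx[OF m(1) finite_acl[OF assms]] by blast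
  have fix_m: "inv g (m x) = x" if "x \<in> ?B" for x using g that by (metis inv_apply(1))
  show thesis
  proof (rule that[of "inv g \<circ> m" "inv g \<circ> m'"])
    show "inv g \<circ> m \<in> S" "inv g \<circ> m' \<in> S"
      using g m closure_comp group_subset_closure inv_mem by auto
    show "(inv g \<circ> m) x = x" "(inv g \<circ> m') x = x" if "x \<in> ?B" for x
      using fix_m m(3) that by auto
    show "range (inv g \<circ> m) \<inter> range (inv g \<circ> m') \<subseteq> ?B"
    proof
      fix z assume "z \<in> range (inv g \<circ> m) \<inter> range (inv g \<circ> m')"
      then obtain x y where z: "z = inv g (m y)" "z = inv g (m' x)"
        by (metis IntE rangeE comp_apply)
      then have "m' x = m y" using inj[OF inv_mem[OF g(1)]] by (metis injD)
      then have "x \<in> ?B" using m(4) by blast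
      then show "z \<in> ?B" using z(2) m(3) fix_m by simp
    qed
  qed
qed

end

section \<open>Embeddings separating a point from a closed set\<close>

context modular_perm_group
begin

text \<open>The two embeddings of \<open>embeddings_covering\<close> are built from group elements \<open>r\<close> and \<open>y\<close>, of
  which only the restrictions to \<open>F\<close> and \<open>H\<close> are kept.\<close>

definition approximation ::
    "'a set \<Rightarrow> 'a \<Rightarrow> ('a \<Rightarrow> 'a) \<Rightarrow> 'a set \<Rightarrow> ('a \<Rightarrow> 'a) \<Rightarrow> 'a set \<Rightarrow> bool" where
  "approximation D b r F y H \<longleftrightarrow> r \<in> G \<and> y \<in> G \<and> finite F \<and> finite H \<and> cl F = F \<and> cl H = H \<and>
     b \<in> F \<and> r b \<notin> cl (r ` (F \<inter> D) \<union> y ` H)"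

text \<open>The new material is generated by \<open>E\<close> over the old avoided set, and
  \<open>E\<close> meets the old configuration only in the closure of that set. The modular law in
  \<open>modular_avoid\<close> therefore keeps \<open>r b\<close> outside.\<close>

lemma approximation_extend:
  assumes app: "approximation D b r F y H"
    and new: "r' \<in> G" "y' \<in> G" "finite F'" "finite H'" "cl F' = F'" "cl H' = H'" "F \<subseteq> F'"
      "\<And>x. x \<in> F \<Longrightarrow> r' x = r x"
    and E: "finite E" "cl E = E" "E \<inter> cl (r ` F \<union> y ` H) \<subseteq> cl (r ` (F \<inter> D) \<union> y ` H)"
    and gen: "r' ` (F' \<inter> D) \<union> y' ` H' \<subseteq> cl (r ` (F \<inter> D) \<union> y ` H \<union> E)"
  shows "approximation D b r' F' y' H'"
proof -
  let ?J = "r ` (F \<inter> D) \<union> y ` H" and ?K = "cl (r ` F \<union> y ` H)"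
  have a: "r \<in> G" "y \<in> G" "finite F" "finite H" "b \<in> F" "r b \<notin> cl ?J"
    using app by (auto simp: approximation_def)
  have sub: "r ` F \<union> y ` H \<subseteq> ?K" by (rule subset_acl)
  have "r b \<notin> cl (?J \<union> E)"
  proof (rule modular_avoid[of ?J ?K])
    show "cl ?K = ?K" "finite ?K" using a acl_acl finite_acl by auto
    show "?J \<subseteq> ?K" "r b \<in> ?K" using sub a(5) by auto
  qed (use a E in auto)
  moreover have "cl (r' ` (F' \<inter> D) \<union> y' ` H') \<subseteq> cl (?J \<union> E)"
    using gen a E(1) by (intro acl_subset) auto
  ultimately show ?thesis
    using new a(5) unfolding approximation_def by auto
qed

text \<open>The new values of \<open>r\<close> are moved off the old configuration. Only those at
  points of \<open>D\<close> enter the avoided set, and any of them that is old comes from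
  \<open>F \<inter> D\<close> by injectivity.\<close>

lemma approximation_extend_left:
  assumes app: "approximation D b r F y H" and D: "alg_closed D" and X: "finite X"
  obtains r' where "approximation D b r' (cl (F \<union> X)) y H" "\<And>x. x \<in> F \<Longrightarrow> r' x = r x"
proof -
  let ?F = "cl (F \<union> X)" and ?J = "r ` (F \<inter> D) \<union> y ` H" and ?K = "cl (r ` F \<union> y ` H)"
  have a: "r \<in> G" "y \<in> G" "finite F" "finite H" "cl F = F" "cl H = H"
    using app by (auto simp: approximation_def)
  have F: "finite ?F" "cl ?F = ?F" "F \<subseteq> ?F"
    using a(3) X finite_acl acl_acl subset_acl[of "F \<union> X"] by auto
  have pre: "finite (r ` ?F)" "cl (r ` ?F) = r ` ?F" "cl (r ` F) = r ` F" "r ` F \<subseteq> r ` ?F" "finite ?K"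
    using F finite_acl[of "r ` F \<union> y ` H"] a(3,4) acl_image_closed[OF a(1)] a(5) by auto
  obtain d where d: "d \<in> G" "\<forall>b\<in>r ` F. d b = b" "d ` r ` ?F \<inter> ?K \<subseteq> r ` F"
    using move_closed_off_finite[OF pre] by blast
  let ?r = "d \<circ> r" and ?E = "(d \<circ> r) ` (?F \<inter> D)"
  have r: "?r \<in> G" using d a comp_mem by blast
  have agree: "?r x = r x" if "x \<in> F" for x using d(2) that by simp
  have "approximation D b ?r ?F y H"
  proof (rule approximation_extend[OF app, where E = ?E])
    show "finite ?E" using F by blast
    show "cl ?E = ?E" using r acl_image_closed acl_Int[OF F(1,2) D] by blast
    show "?E \<inter> ?K \<subseteq> cl ?J"
    proof
      fix z assume z: "z \<in> ?E \<inter> ?K"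
      then obtain x where x: "x \<in> ?F" "x \<in> D" "z = ?r x" by blast
      then have "z \<in> r ` F" using d(3) z by (auto simp: image_comp)
      then obtain x' where "x' \<in> F" "z = ?r x'" using agree by auto
      then have "x' = x" using inj[OF r] x(3) by (metis injD)
      then have "z \<in> ?J" using \<open>x' \<in> F\<close> x agree by auto
      then show "z \<in> cl ?J" by (rule subsetD[OF subset_acl])
    qed
    show "?E \<union> y ` H \<subseteq> cl (?J \<union> ?E)" using subset_acl[of "?J \<union> ?E"] by blast
  qed (use r a F agree in auto)
  then show thesis by (rule that) (rule agree)
qed

lemma approximation_extend_right:
  assumes app: "approximation D b r F y H" and X: "finite X"
  obtains y' where "approximation D b r F y' (cl (H \<union> X))" "\<And>x. x \<in> H \<Longrightarrow> y' x = y x"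
proof -
  let ?H = "cl (H \<union> X)" and ?J = "r ` (F \<inter> D) \<union> y ` H" and ?K = "cl (r ` F \<union> y ` H)"
  have a: "r \<in> G" "y \<in> G" "finite F" "finite H" "cl F = F" "cl H = H"
    using app by (auto simp: approximation_def)
  have H: "finite ?H" "cl ?H = ?H" "H \<subseteq> ?H"
    using a(4) X finite_acl acl_acl subset_acl[of "H \<union> X"] by auto
  have pre: "finite (y ` ?H)" "cl (y ` ?H) = y ` ?H" "cl (y ` H) = y ` H" "y ` H \<subseteq> y ` ?H" "finite ?K"
    using H finite_acl[of "r ` F \<union> y ` H"] a(3,4) acl_image_closed[OF a(2)] a(6) by auto
  obtain d where d: "d \<in> G" "\<forall>b\<in>y ` H. d b = b" "d ` y ` ?H \<inter> ?K \<subseteq> y ` H"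
    using move_closed_off_finite[OF pre] by blast
  let ?y = "d \<circ> y" and ?E = "(d \<circ> y) ` ?H"
  have y: "?y \<in> G" using d a comp_mem by blast
  have "approximation D b r F ?y ?H"
  proof (rule approximation_extend[OF app, where E = ?E])
    show "finite ?E" using H by blast
    show "cl ?E = ?E" using y acl_image_closed H by blast
    have "?E = d ` y ` ?H" by (simp add: image_comp)
    then show "?E \<inter> ?K \<subseteq> cl ?J" using d(3) subset_acl[of ?J] by blast
    show "r ` (F \<inter> D) \<union> ?E \<subseteq> cl (?J \<union> ?E)" using subset_acl[of "?J \<union> ?E"] by blast
  qed (use y a H in auto)
  then show thesis using that d(2) by simp
qed

text \<open>A copy of \<open>X\<close> over the image of \<open>A\<close> under \<open>r\<close> is
  moved off the old configuration. It can meet it only in images of points of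
  \<open>A \<inter> X\<close>; these lie in \<open>D\<close>, so they were already in the avoided
  set.\<close>

lemma approximation_cover:
  assumes app: "approximation D b r F y H"
    and A: "A \<subseteq> F" "finite A" "cl A = A" and X: "finite X" "cl X = X" "A \<inter> X \<subseteq> D"
  obtains k H' where "approximation D b r F y H'" "H \<subseteq> H'" "k \<in> G" "\<And>a. a \<in> A \<Longrightarrow> k a = r a"
    "k ` X \<subseteq> y ` H'"
proof -
  let ?J = "r ` (F \<inter> D) \<union> y ` H" and ?K = "cl (r ` F \<union> y ` H)" and ?X = "cl (A \<union> X)"
  have a: "r \<in> G" "y \<in> G" "finite F" "finite H" "cl F = F" "cl H = H"
    using app by (auto simp: approximation_def)
  have AX: "finite ?X" "cl ?X = ?X" "A \<union> X \<subseteq> ?X"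
    using A X finite_acl acl_acl subset_acl[of "A \<union> X"] by auto
  have pre: "finite (r ` ?X)" "cl (r ` ?X) = r ` ?X" "cl (r ` A) = r ` A" "r ` A \<subseteq> r ` ?X" "finite ?K"
    using AX finite_acl[of "r ` F \<union> y ` H"] a(3,4) acl_image_closed[OF a(1)] A(3) by auto
  obtain d where d: "d \<in> G" "\<forall>b\<in>r ` A. d b = b" "d ` r ` ?X \<inter> ?K \<subseteq> r ` A"
    using move_closed_off_finite[OF pre] by blast
  let ?k = "d \<circ> r"
  have k: "?k \<in> G" using d a comp_mem by blast
  have agree: "?k x = r x" if "x \<in> A" for x using d(2) that by simp
  \<comment> \<open>The copy \<open>?E\<close> is pulled back along \<open>y\<close>, so enlarging
    \<open>H\<close> suffices and \<open>y\<close> itself stays unchanged.\<close>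
  let ?E = "?k ` X" and ?H = "cl (H \<union> inv y ` ?k ` X)"
  have H: "finite ?H" "cl ?H = ?H" "H \<union> inv y ` ?k ` X \<subseteq> ?H"
    using a(4) X(1) finite_acl acl_acl subset_acl[of "H \<union> inv y ` ?k ` X"] by auto
  have yH: "y ` ?H = cl (y ` H \<union> ?E)"
    using acl_image[OF a(2), of "H \<union> inv y ` ?k ` X"] a(2) by (simp add: image_Un image_image)
  have "approximation D b r F y ?H"
  proof (rule approximation_extend[OF app, where E = ?E])
    show "finite ?E" using X by blast
    show "cl ?E = ?E" using k acl_image_closed X by blast
    show "?E \<inter> ?K \<subseteq> cl ?J"
    proof
      fix z assume z: "z \<in> ?E \<inter> ?K"
      then obtain x where x: "x \<in> X" "z = ?k x" by blast
      then have "z \<in> d ` r ` ?X" using AX(3) by auto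
      then have "z \<in> r ` A" using d(3) z by blast
      then obtain x' where "x' \<in> A" "z = ?k x'" using agree by auto
      then have "x' = x" using inj[OF k] x(2) by (metis injD)
      then have "z \<in> ?J" using \<open>x' \<in> A\<close> x A X agree by auto
      then show "z \<in> cl ?J" by (rule subsetD[OF subset_acl])
    qed
    have "y ` ?H \<subseteq> cl (?J \<union> ?E)" unfolding yH by (intro acl_mono) blast
    then show "r ` (F \<inter> D) \<union> y ` ?H \<subseteq> cl (?J \<union> ?E)" using subset_acl[of "?J \<union> ?E"] by blast
  qed (use a H in auto)
  moreover have "?k ` X \<subseteq> y ` ?H" unfolding yH using subset_acl[of "y ` H \<union> ?E"] by blast
  moreover have "H \<subseteq> ?H" using H(3) by blast
  ultimately show thesis using k agree that[of ?H ?k] by simp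
qed

lemma approximation_step:
  assumes app: "approximation D b r F y H" and D: "alg_closed D"
    and A: "finite A" "cl A = A" and X: "finite X" "cl X = X"
  shows "\<exists>r' F' y' H'. approximation D b r' F' y' H' \<and> F \<union> A \<subseteq> F' \<and> H \<union> X \<subseteq> H' \<and>
    (\<forall>x\<in>F. r' x = r x) \<and> (\<forall>x\<in>H. y' x = y x) \<and>
    (A \<inter> X \<subseteq> D \<longrightarrow> (\<exists>k\<in>G. (\<forall>a\<in>A. k a = r' a) \<and> k ` X \<subseteq> y' ` H'))"
proof -
  obtain r' where r': "approximation D b r' (cl (F \<union> A)) y H" "\<And>x. x \<in> F \<Longrightarrow> r' x = r x"
    using approximation_extend_left[OF app D A(1)] by blast
  obtain y' where y': "approximation D b r' (cl (F \<union> A)) y' (cl (H \<union> X))" "\<And>x. x \<in> H \<Longrightarrow> y' x = y x"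
    using approximation_extend_right[OF r'(1) X(1)] by blast
  have F: "F \<union> A \<subseteq> cl (F \<union> A)" and H: "H \<union> X \<subseteq> cl (H \<union> X)" by (rule subset_acl)+
  show ?thesis
  proof (cases "A \<inter> X \<subseteq> D")
    case True
    have "A \<subseteq> cl (F \<union> A)" using F by simp
    from approximation_cover[OF y'(1) this A X True]
    obtain k H' where "approximation D b r' (cl (F \<union> A)) y' H'" "cl (H \<union> X) \<subseteq> H'" "k \<in> G"
      "\<forall>a\<in>A. k a = r' a" "k ` X \<subseteq> y' ` H'"
      by metis
    moreover from this have "\<exists>k\<in>G. (\<forall>a\<in>A. k a = r' a) \<and> k ` X \<subseteq> y' ` H'" by blast
    ultimately show ?thesis using r'(2) y'(2) F H
      by (intro exI[of _ r'] exI[of _ "cl (F \<union> A)"] exI[of _ y'] exI[of _ H']) auto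
  next
    case False
    then show ?thesis using r' y' F H
      by (intro exI[of _ r'] exI[of _ "cl (F \<union> A)"] exI[of _ y'] exI[of _ "cl (H \<union> X)"]) simp
  qed
qed

text \<open>The countably many pairs of finite closed sets are treated one per stage by
  \<open>approximation_step\<close>. Later stages never change the values of \<open>r\<close> and
  \<open>y\<close> already fixed, so each pair needs treatment only once.\<close>

lemma embeddings_covering:
  assumes D: "alg_closed D" and b: "b \<notin> D"
  obtains r y where "r \<in> S" "y \<in> S" "\<And>F. finite F \<Longrightarrow> F \<subseteq> range y \<Longrightarrow> r b \<notin> cl F"
    "\<And>A X. finite A \<Longrightarrow> cl A = A \<Longrightarrow> finite X \<Longrightarrow> cl X = X \<Longrightarrow> A \<inter> X \<subseteq> D \<Longrightarrow>
      \<exists>k\<in>G. (\<forall>a\<in>A. k a = r a) \<and> k ` X \<subseteq> range y"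
proof -
  define B where "B = {A. finite A \<and> cl A = A}"
  have cB: "countable (B \<times> B)"
    using countable_Collect_finite_subset[OF countable_UNIV] unfolding B_def
    by (intro countable_SIGMA countable_subset[of "{A. finite A \<and> cl A = A}" "{A. finite A \<and> A \<subseteq> UNIV}"]) auto
  have clB: "cl F \<in> B" if "finite F" for F
    using that by (simp add: B_def finite_acl acl_acl)
  define t where "t = from_nat_into (B \<times> B)"
  have t: "range t = B \<times> B" unfolding t_def using cB clB[of "{}"] by (intro range_from_nat_into) auto
  let ?P = "\<lambda>(r, F, y, H). approximation D b r F y H"
  let ?Q = "\<lambda>n (r, F, y, H) (r', F', y', H'). F \<union> fst (t n) \<subseteq> F' \<and> H \<union> snd (t n) \<subseteq> H' \<and>
    (\<forall>x\<in>F. r' x = r x) \<and> (\<forall>x\<in>H. y' x = y x) \<and>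
    (fst (t n) \<inter> snd (t n) \<subseteq> D \<longrightarrow>
      (\<exists>k\<in>G. (\<forall>a\<in>fst (t n). k a = r' a) \<and> k ` snd (t n) \<subseteq> y' ` H'))"
  have "\<exists>f. \<forall>n. ?P (f n) \<and> ?Q n (f n) (f (Suc n))"
  proof (rule dependent_nat_choice)
    let ?F = "cl {b}"
    \<comment> \<open>At the start the avoided set lies in the closed set \<open>D\<close>, which
      does not contain \<open>b\<close>.\<close>
    have "cl {} \<subseteq> D" using D by (simp add: alg_closed_def)
    then have "cl (?F \<inter> D \<union> cl {}) \<subseteq> D" using D finite_acl by (simp add: alg_closed_def)
    then have "approximation D b id ?F id (cl {})"
      using b subset_acl[of "{b}"] id_mem finite_acl acl_acl unfolding approximation_def by auto
    then show "\<exists>x. ?P x" by blast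
  next
    fix x n assume "?P x"
    then obtain r F y H where x: "x = (r, F, y, H)" "approximation D b r F y H" by (cases x) auto
    have "t n \<in> B \<times> B" using t by blast
    then have "\<exists>r' F' y' H'. approximation D b r' F' y' H' \<and> F \<union> fst (t n) \<subseteq> F' \<and> H \<union> snd (t n) \<subseteq> H' \<and>
      (\<forall>x\<in>F. r' x = r x) \<and> (\<forall>x\<in>H. y' x = y x) \<and>
      (fst (t n) \<inter> snd (t n) \<subseteq> D \<longrightarrow>
        (\<exists>k\<in>G. (\<forall>a\<in>fst (t n). k a = r' a) \<and> k ` snd (t n) \<subseteq> y' ` H'))"
      by (intro approximation_step[OF x(2) D]) (auto simp: B_def)
    then show "\<exists>y. ?P y \<and> ?Q n x y" using x by auto
  qed
  then obtain f where f: "\<forall>n. ?P (f n) \<and> ?Q n (f n) (f (Suc n))" by (elim exE)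
  define r F y H where "r = (\<lambda>n. fst (f n))" and "F = (\<lambda>n. fst (snd (f n)))"
    and "y = (\<lambda>n. fst (snd (snd (f n))))" and "H = (\<lambda>n. snd (snd (snd (f n))))"
  have app: "approximation D b (r n) (F n) (y n) (H n)" for n
    using spec[OF f, of n] by (simp add: r_def F_def y_def H_def case_prod_beta)
  have step: "F n \<union> fst (t n) \<subseteq> F (Suc n) \<and> H n \<union> snd (t n) \<subseteq> H (Suc n) \<and>
    (\<forall>x\<in>F n. r (Suc n) x = r n x) \<and> (\<forall>x\<in>H n. y (Suc n) x = y n x) \<and>
    (fst (t n) \<inter> snd (t n) \<subseteq> D \<longrightarrow>
      (\<exists>k\<in>G. (\<forall>a\<in>fst (t n). k a = r (Suc n) a) \<and> k ` snd (t n) \<subseteq> y (Suc n) ` H (Suc n)))" for n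
    using spec[OF f, of n] by (simp add: r_def F_def y_def H_def case_prod_beta)
  have mono: "F n \<subseteq> F (Suc n)" "H n \<subseteq> H (Suc n)" for n using step[of n] by blast+
  have exhaust: "(\<Union>n. F n) = UNIV" "(\<Union>n. H n) = UNIV"
  proof -
    have "\<exists>n. x \<in> F n \<and> x \<in> H n" for x
    proof -
      have "(cl {x}, cl {x}) \<in> range t" using t clB by simp
      then obtain n where "t n = (cl {x}, cl {x})" by (metis rangeE)
      then show ?thesis using step[of n] subset_acl[of "{x}"] by auto
    qed
    then show "(\<Union>n. F n) = UNIV" "(\<Union>n. H n) = UNIV" by blast+
  qed
  obtain r\<^sub>0 where r0: "\<And>n x. x \<in> F n \<Longrightarrow> r\<^sub>0 x = r n x"
    using chain_limit[of F r] mono exhaust step by blast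
  obtain y\<^sub>0 where y0: "\<And>n x. x \<in> H n \<Longrightarrow> y\<^sub>0 x = y n x"
    using chain_limit[of H y] mono exhaust step by blast
  have G: "r n \<in> G" "y n \<in> G" for n using app by (auto simp: approximation_def)
  show thesis
  proof (rule that)
    show "r\<^sub>0 \<in> S" by (rule closure_limit[OF G(1) r0 mono(1) exhaust(1)])
    show "y\<^sub>0 \<in> S" by (rule closure_limit[OF G(2) y0 mono(2) exhaust(2)])
    fix E assume E: "finite E" "E \<subseteq> range y\<^sub>0"
    have "mono H" using mono by (simp add: mono_iff_le_Suc)
    \<comment> \<open>A finite part of the range is present at some stage, whose invariant keeps
      \<open>r b\<close> out of its closure.\<close>
    have "\<exists>n. E \<subseteq> y\<^sub>0 ` H n" using E
    proof (induction E)
      case (insert e E)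
      then obtain n x where "E \<subseteq> y\<^sub>0 ` H n" "e = y\<^sub>0 x" by auto
      moreover obtain m where "x \<in> H m" using exhaust by blast
      ultimately have "Set.insert e E \<subseteq> y\<^sub>0 ` H (max n m)"
        using monoD[OF \<open>mono H\<close>, of n "max n m"] monoD[OF \<open>mono H\<close>, of m "max n m"] by auto
      then show ?case ..
    qed simp
    then obtain n where "E \<subseteq> y n ` H n" using y0 by auto
    then have "cl E \<subseteq> cl (r n ` (F n \<inter> D) \<union> y n ` H n)" by (intro acl_mono) auto
    moreover have "r\<^sub>0 b = r n b" using r0 app by (simp add: approximation_def)
    ultimately show "r\<^sub>0 b \<notin> cl E" using app[of n] by (auto simp: approximation_def)
  next
    fix A X assume "finite A" "cl A = A" "finite X" "cl X = X" "A \<inter> X \<subseteq> D"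
    then have "(A, X) \<in> range t" using t by (simp add: B_def)
    then obtain n where n: "t n = (A, X)" by (metis rangeE)
    then obtain k where k: "k \<in> G" "\<forall>a\<in>A. k a = r (Suc n) a" "k ` X \<subseteq> y (Suc n) ` H (Suc n)"
      using step[of n] \<open>A \<inter> X \<subseteq> D\<close> by auto
    have "\<forall>a\<in>A. k a = r\<^sub>0 a" using k(2) r0[of _ "Suc n"] step[of n] n by auto
    moreover have "k ` X \<subseteq> range y\<^sub>0"
    proof -
      have "y (Suc n) ` H (Suc n) = y\<^sub>0 ` H (Suc n)" by (rule image_cong) (simp_all add: y0)
      then show ?thesis using k(3) by blast
    qed
    ultimately show "\<exists>k\<in>G. (\<forall>a\<in>A. k a = r\<^sub>0 a) \<and> k ` X \<subseteq> range y\<^sub>0" using k(1) by blast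
  qed
qed

text \<open>The point is that \<open>g\<close> and \<open>h\<close> do not depend on \<open>A\<close>, \<open>C\<close> and \<open>e\<close>: the range of \<open>y\<close> contains a
  copy over \<open>r ` A\<close> of each finite closed set that meets \<open>A\<close> inside \<open>D\<close>, and two embeddings that
  agree on this range can still separate \<open>r b\<close>.\<close>

lemma separating_embeddings:
  assumes D: "alg_closed D" and b: "b \<notin> D"
  obtains g h where "g \<in> S" "h \<in> S" "g b \<noteq> h b"
    "\<And>A C e. finite A \<Longrightarrow> cl A = A \<Longrightarrow> finite C \<Longrightarrow> cl C = C \<Longrightarrow> e \<in> S \<Longrightarrow> A \<inter> e ` C \<subseteq> D \<Longrightarrow>
      \<exists>e'\<in>S. \<exists>p\<in>S. \<exists>p'\<in>S. (\<forall>x\<in>C. e' x = e x) \<and> (\<forall>x\<in>A. p x = g x) \<and> (\<forall>x\<in>A. p' x = h x) \<and>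
        p \<circ> e' = p' \<circ> e'"
proof -
  obtain r y where r: "r \<in> S" and y: "y \<in> S" and rb: "\<And>F. finite F \<Longrightarrow> F \<subseteq> range y \<Longrightarrow> r b \<notin> cl F"
    and cover: "\<And>A X. finite A \<Longrightarrow> cl A = A \<Longrightarrow> finite X \<Longrightarrow> cl X = X \<Longrightarrow> A \<inter> X \<subseteq> D \<Longrightarrow>
      \<exists>k\<in>G. (\<forall>a\<in>A. k a = r a) \<and> k ` X \<subseteq> range y"
    by (fact embeddings_covering[OF D b])
  obtain m m' where m: "m \<in> S" "m' \<in> S" "\<And>z. z \<in> range y \<Longrightarrow> m' z = m z" "m' (r b) \<noteq> m (r b)"
    using embeddings_agreeing_on[of "range y" "r b"] rb by blast
  show thesis
  proof (rule that[of "m \<circ> r" "m' \<circ> r"])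
    show "m \<circ> r \<in> S" "m' \<circ> r \<in> S" "(m \<circ> r) b \<noteq> (m' \<circ> r) b"
      using m r closure_comp by auto
    fix A C e assume A: "finite A" "cl A = A" and C: "finite C" "cl C = C" and e: "e \<in> S"
      and AC: "A \<inter> e ` C \<subseteq> D"
    have "cl (e ` C) = e ` C" using acl_closure_image[OF e C(1)] C(2) by simp
    then obtain k where k: "k \<in> G" "\<And>a. a \<in> A \<Longrightarrow> k a = r a" "k ` e ` C \<subseteq> range y"
      using cover[OF A, of "e ` C"] C(1) AC by blast
    obtain Q where Q: "finite Q" "k ` e ` C = y ` Q"
      using finite_subset_image[OF _ k(3)] C(1) by blast
    obtain u where u: "u \<in> G" "\<And>x. x \<in> Q \<Longrightarrow> u x = y x" using closure_approx[OF y Q(1)] by blast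
    obtain v where v: "v \<in> G" "\<And>x. x \<in> C \<Longrightarrow> v x = e x" using closure_approx[OF e C(1)] by blast
    \<comment> \<open>\<open>?w\<close> is a group element that sends \<open>C\<close> into
      \<open>Q\<close> in such a way that \<open>y \<circ> ?w\<close> and \<open>k \<circ> e\<close>
      agree on \<open>C\<close>.\<close>
    let ?w = "inv u \<circ> (k \<circ> v)"
    have w: "?w \<in> G" by (intro comp_mem inv_mem u(1) v(1) k(1))
    have yw: "y (?w x) = k (e x)" if "x \<in> C" for x
    proof -
      have "k (e x) \<in> y ` Q" unfolding Q(2)[symmetric] using that by simp
      then obtain q where q: "q \<in> Q" "k (e x) = y q" by (elim imageE)
      have "?w x = inv u (u q)" using v(2)[OF that] u(2)[OF q(1)] q(2) by simp
      then have "?w x = q" using inv_apply(1)[OF u(1)] by simp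
      then show ?thesis using q by simp
    qed
    have k': "inv k \<in> S" "k \<in> S" using k(1) inv_mem group_subset_closure by blast+
    \<comment> \<open>\<open>k \<circ> e'\<close> takes values in the range of \<open>y\<close>,
      where \<open>m\<close> and \<open>m'\<close> agree; on \<open>A\<close> the factor
      \<open>k\<close> acts as \<open>r\<close>.\<close>
    define e' p p' where "e' = inv k \<circ> (y \<circ> ?w)" and "p = m \<circ> k" and "p' = m' \<circ> k"
    have "p \<circ> e' = p' \<circ> e'"
      using m(3) k(1) unfolding e'_def p_def p'_def by (intro ext) simp
    moreover have "e' \<in> S"
      unfolding e'_def using k' y w closure_comp group_subset_closure by blast
    moreover have "p \<in> S" "p' \<in> S" unfolding p_def p'_def using m k' closure_comp by blast+
    moreover have "\<forall>x\<in>C. e' x = e x"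
    proof
      fix x assume "x \<in> C"
      have "e' x = inv k (y (?w x))" by (simp add: e'_def)
      then show "e' x = e x" using yw[OF \<open>x \<in> C\<close>] inv_apply(1)[OF k(1)] by simp
    qed
    moreover have "\<forall>x\<in>A. p x = (m \<circ> r) x" "\<forall>x\<in>A. p' x = (m' \<circ> r) x"
      using k(2) by (auto simp: p_def p'_def)
    ultimately show "\<exists>e'\<in>S. \<exists>p\<in>S. \<exists>p'\<in>S. (\<forall>x\<in>C. e' x = e x) \<and> (\<forall>x\<in>A. p x = (m \<circ> r) x) \<and>
        (\<forall>x\<in>A. p' x = (m' \<circ> r) x) \<and> p \<circ> e' = p' \<circ> e'"
      by blast
  qed
qed

end

section \<open>Semigroup topologies coarser than pointwise convergence\<close>

lemma semigroup_topology_comp_nbhd: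
  assumes T: "Hausdorff_semigroup_topology S T"
    and "f \<in> S" "g \<in> S" and U: "openin T U" "f \<circ> g \<in> U"
  obtains P Q where "openin T P" "openin T Q" "f \<in> P" "g \<in> Q"
    "\<And>p q. p \<in> P \<Longrightarrow> q \<in> Q \<Longrightarrow> p \<circ> q \<in> U"
proof -
  have top: "topspace T = S" and cont: "continuous_map (prod_topology T T) T (\<lambda>(f, g). f \<circ> g)"
    using T by (auto simp: Hausdorff_semigroup_topology_def)
  define W where "W = {x \<in> topspace (prod_topology T T). (\<lambda>(f, g). f \<circ> g) x \<in> U}"
  have "openin (prod_topology T T) W"
    unfolding W_def using cont U(1) by (rule openin_continuous_map_preimage)
  moreover have "(f, g) \<in> W" using assms top by (simp add: W_def)
  ultimately have "\<exists>P Q. openin T P \<and> openin T Q \<and> f \<in> P \<and> g \<in> Q \<and> P \<times> Q \<subseteq> W"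
    by (rule iffD1[OF openin_prod_topology_alt, rule_format])
  then obtain P Q where PQ: "openin T P" "openin T Q" "f \<in> P" "g \<in> Q" "P \<times> Q \<subseteq> W"
    by (elim exE conjE)
  have "p \<circ> q \<in> U" if "p \<in> P" "q \<in> Q" for p q
    using subsetD[OF PQ(5), of "(p, q)"] that by (simp add: W_def)
  then show thesis by (rule that[OF PQ(1-4)])
qed

section \<open>Neighbourhoods in the topology of pointwise convergence\<close>

lemma openin_pointwise_basic:
  assumes "finite F" shows "openin pointwise_topology {s. \<forall>x\<in>F. s x = f x}"
proof -
  have "openin pointwise_topology (\<Pi>\<^sub>E x\<in>UNIV. if x \<in> F then {f x} else UNIV)"
    unfolding pointwise_topology_def
    by (subst openin_PiE_gen) (auto intro: finite_subset[OF _ assms] split: if_splits)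
  moreover have "(\<Pi>\<^sub>E x\<in>UNIV. if x \<in> F then {f x} else UNIV) = {s. \<forall>x\<in>F. s x = f x}"
    by (auto simp: PiE_UNIV_domain Pi_iff split: if_splits)
  ultimately show ?thesis by simp
qed

lemma openin_pointwise_nbhd:
  assumes "openin pointwise_topology U" "f \<in> U"
  obtains F where "finite F" "\<And>s. (\<And>x. x \<in> F \<Longrightarrow> s x = f x) \<Longrightarrow> s \<in> U"
proof -
  obtain B where B: "finite {i. B i \<noteq> UNIV}" "f \<in> Pi\<^sub>E UNIV B" "Pi\<^sub>E UNIV B \<subseteq> U"
    using assms unfolding pointwise_topology_def openin_product_topology_alt by force
  have "s \<in> U" if "\<And>x. x \<in> {i. B i \<noteq> UNIV} \<Longrightarrow> s x = f x" for s
  proof -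
    have "s x \<in> B x" for x using that[of x] B(2) by (cases "B x = UNIV") (auto simp: PiE_iff)
    then show ?thesis using B(3) by (auto simp: PiE_iff)
  qed
  then show thesis using that B(1) by blast
qed

lemma topspace_pointwise [simp]: "topspace pointwise_topology = UNIV"
  by (simp add: pointwise_topology_def)

lemma pointwise_closure_of: "pointwise_topology closure_of G = pointwise_closure G"
proof (intro set_eqI iffI)
  fix s assume s: "s \<in> pointwise_topology closure_of G"
  show "s \<in> pointwise_closure G" unfolding pointwise_closure_def
  proof (safe)
    fix F :: "'a set" assume "finite F"
    define U where "U = {t. \<forall>x\<in>F. t x = s x}"
    have "openin pointwise_topology U" "s \<in> U"
      using openin_pointwise_basic[OF \<open>finite F\<close>] by (simp_all add: U_def)
    then have "\<exists>g. g \<in> G \<and> g \<in> U" using s unfolding in_closure_of by blast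
    then show "\<exists>g\<in>G. \<forall>x\<in>F. g x = s x" by (auto simp: U_def)
  qed
next
  fix s assume s: "s \<in> pointwise_closure G"
  show "s \<in> pointwise_topology closure_of G" unfolding in_closure_of
  proof (safe)
    fix U assume "s \<in> U" "openin pointwise_topology U"
    then obtain F where F: "finite F" "\<And>t. (\<And>x. x \<in> F \<Longrightarrow> t x = s x) \<Longrightarrow> t \<in> U"
      using openin_pointwise_nbhd by blast
    then obtain g where "g \<in> G" "\<forall>x\<in>F. g x = s x" using s unfolding pointwise_closure_def by blast
    then show "\<exists>t. t \<in> G \<and> t \<in> U" using F(2) by blast
  qed simp
qed

lemma pointwise_Hausdorff_semigroup:
  assumes comp: "\<And>f g. f \<in> S \<Longrightarrow> g \<in> S \<Longrightarrow> f \<circ> g \<in> S"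
  shows "Hausdorff_semigroup_topology S (subtopology pointwise_topology S)" (is "Hausdorff_semigroup_topology _ ?T")
  unfolding Hausdorff_semigroup_topology_def
proof (intro conjI)
  show top: "topspace ?T = S" by simp
  have "Hausdorff_space (pointwise_topology :: ('a \<Rightarrow> 'a) topology)"
    unfolding pointwise_topology_def by (simp add: Hausdorff_space_product_topology)
  then show "Hausdorff_space ?T" by (rule Hausdorff_space_subtopology)
  show "continuous_map (prod_topology ?T ?T) ?T (\<lambda>(f, g). f \<circ> g)"
    unfolding continuous_map
  proof (intro conjI allI impI)
    show "(\<lambda>(f, g). f \<circ> g) ` topspace (prod_topology ?T ?T) \<subseteq> topspace ?T"
      using comp by auto
    fix U assume "openin ?T U"
    then obtain V where V: "openin pointwise_topology V" "U = V \<inter> S" by (auto simp: openin_subtopology)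
    let ?W = "{x \<in> topspace (prod_topology ?T ?T). (\<lambda>(f, g). f \<circ> g) x \<in> U}"
    show "openin (prod_topology ?T ?T) ?W" unfolding openin_prod_topology_alt
    proof (intro allI impI)
      fix f g assume fg: "(f, g) \<in> ?W"
      then have "f \<circ> g \<in> V" using V by simp
      then obtain F where F: "finite F" "\<And>s. (\<And>x. x \<in> F \<Longrightarrow> s x = (f \<circ> g) x) \<Longrightarrow> s \<in> V"
        using openin_pointwise_nbhd[OF V(1)] by blast
      \<comment> \<open>Fixing \<open>g\<close> on \<open>F\<close> leaves only the values of
        \<open>f\<close> on the image of \<open>F\<close> to be controlled.\<close>
      let ?P = "{s. \<forall>x\<in>g ` F. s x = f x} \<inter> S" and ?Q = "{s. \<forall>x\<in>F. s x = g x} \<inter> S"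
      have "openin ?T ?P" "openin ?T ?Q"
        using openin_pointwise_basic[of "g ` F" f] openin_pointwise_basic[OF F(1), of g] F(1)
        by (simp_all add: openin_subtopology_Int)
      moreover have "?P \<times> ?Q \<subseteq> ?W" using comp V(2) by (auto intro!: F(2))
      ultimately show "\<exists>P Q. openin ?T P \<and> openin ?T Q \<and> f \<in> P \<and> g \<in> Q \<and> P \<times> Q \<subseteq> ?W"
        using fg by (intro exI[of _ ?P] exI[of _ ?Q]) auto
    qed
  qed
qed

section \<open>Partial limits in a coarser semigroup topology\<close>

text \<open>A failure of \<open>T\<close> to refine the topology of pointwise convergence at \<open>s\<^sub>0\<close>, in the
  coordinate \<open>a\<^sub>0\<close>; it leads to a contradiction.\<close>

locale coarse_semigroup_topology = modular_perm_group G
  for G :: "('a \<Rightarrow> 'a) set" +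
  fixes T :: "('a \<Rightarrow> 'a) topology" and s\<^sub>0 :: "'a \<Rightarrow> 'a" and a\<^sub>0 :: 'a
  assumes T: "Hausdorff_semigroup_topology S T"
    and coarse: "openin T U \<Longrightarrow> openin (subtopology pointwise_topology S) U"
    and s0: "s\<^sub>0 \<in> S"
    and not_finer: "openin T Q \<Longrightarrow> s\<^sub>0 \<in> Q \<Longrightarrow> \<exists>s\<in>Q. s a\<^sub>0 \<noteq> s\<^sub>0 a\<^sub>0"
begin

lemma topspace_T [simp]: "topspace T = S"
  using T by (simp add: Hausdorff_semigroup_topology_def)

lemma openin_T_subset: "openin T U \<Longrightarrow> U \<subseteq> S"
  using openin_subset by fastforce

lemma separate:
  assumes "f \<in> S" "g \<in> S" "f \<noteq> g"
  obtains U V where "openin T U" "openin T V" "f \<in> U" "g \<in> V" "U \<inter> V = {}"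
  using T assms unfolding Hausdorff_semigroup_topology_def Hausdorff_space_def disjnt_def
  by (metis topspace_T)

lemma T_nbhd:
  assumes "openin T U" "f \<in> U"
  obtains F where "finite F" "\<And>s. s \<in> S \<Longrightarrow> (\<And>x. x \<in> F \<Longrightarrow> s x = f x) \<Longrightarrow> s \<in> U"
proof -
  obtain V where "openin pointwise_topology V" "U = V \<inter> S"
    using coarse[OF assms(1)] by (auto simp: openin_subtopology)
  then show thesis using openin_pointwise_nbhd[of V f] assms(2) that by (metis IntD1 IntI)
qed

text \<open>The maximal sets of constraints \<open>s x = z\<close> that are consistent with \<open>s \<longlongrightarrow> s\<^sub>0\<close> in \<open>T\<close> and
  \<open>s a\<^sub>0 \<noteq> s\<^sub>0 a\<^sub>0\<close> play the role of pointwise limits along an ultrafilter.\<close>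

definition consistent :: "('a \<times> 'a) set \<Rightarrow> bool" where
  "consistent Z \<longleftrightarrow> (\<forall>Z' Q. finite Z' \<longrightarrow> Z' \<subseteq> Z \<longrightarrow> openin T Q \<longrightarrow> s\<^sub>0 \<in> Q \<longrightarrow>
     (\<exists>s\<in>Q. s a\<^sub>0 \<noteq> s\<^sub>0 a\<^sub>0 \<and> (\<forall>(x, z)\<in>Z'. s x = z)))"

text \<open>Consistency tests finite subsets only, so it passes to unions of chains and Zorn's lemma
  applies.\<close>

lemma maximal_consistent:
  obtains Z where "consistent Z" "\<And>p. p \<notin> Z \<Longrightarrow> \<not> consistent (insert p Z)"
proof -
  have "\<exists>Z\<in>Collect consistent. \<forall>X\<in>Collect consistent. Z \<subseteq> X \<longrightarrow> X = Z"
  proof (rule subset_Zorn_nonempty)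
    have "consistent {}" using not_finer unfolding consistent_def by auto
    then show "Collect consistent \<noteq> {}" by blast
    fix C assume C: "C \<noteq> {}" "subset.chain (Collect consistent) C"
    have "consistent (\<Union>C)" unfolding consistent_def
    proof (intro allI impI)
      fix Z' Q assume a: "finite Z'" "Z' \<subseteq> \<Union>C" "openin T Q" "s\<^sub>0 \<in> Q"
      then obtain Z where "Z \<in> C" "Z' \<subseteq> Z" using finite_subset_Union_chain[OF a(1,2) C] by blast
      moreover have "consistent Z" using C(2) \<open>Z \<in> C\<close> unfolding subset.chain_def by blast
      ultimately show "\<exists>s\<in>Q. s a\<^sub>0 \<noteq> s\<^sub>0 a\<^sub>0 \<and> (\<forall>(x, z)\<in>Z'. s x = z)"
        using a unfolding consistent_def by blast
    qed
    then show "\<Union>C \<in> Collect consistent" by simp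
  qed
  then obtain Z where Z: "consistent Z" "\<forall>X\<in>Collect consistent. Z \<subseteq> X \<longrightarrow> X = Z" by blast
  have "\<not> consistent (insert p Z)" if "p \<notin> Z" for p using Z(2) that by blast
  then show thesis using that Z(1) by blast
qed

text \<open>\<open>V\<close> is the domain of a maximal consistent \<open>Z\<close>, and \<sigma>
  selects values from it. Each pair outside \<open>Z\<close> is refuted by finitely many constraints
  from \<open>Z\<close> together with a neighbourhood of \<open>s\<^sub>0\<close>. Finitely many
  refutations combine, which excludes values in \<open>A\<close> at points outside
  \<open>V\<close>.\<close>

lemma partial_limit:
  obtains V \<sigma> where "\<And>X A Q. finite X \<Longrightarrow> finite A \<Longrightarrow> openin T Q \<Longrightarrow> s\<^sub>0 \<in> Q \<Longrightarrow>
    \<exists>s\<in>Q. s a\<^sub>0 \<noteq> s\<^sub>0 a\<^sub>0 \<and> (\<forall>x\<in>X. if x \<in> V then s x = \<sigma> x else s x \<notin> A)"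
proof -
  obtain Z where Z: "consistent Z" "\<And>p. p \<notin> Z \<Longrightarrow> \<not> consistent (insert p Z)"
    using maximal_consistent by blast
  have avoid: "\<exists>Z' Q. finite Z' \<and> Z' \<subseteq> Z \<and> openin T Q \<and> s\<^sub>0 \<in> Q \<and>
      (\<forall>s\<in>Q. s a\<^sub>0 \<noteq> s\<^sub>0 a\<^sub>0 \<longrightarrow> (\<forall>(x, z)\<in>Z'. s x = z) \<longrightarrow> (\<forall>(x, z)\<in>N. s x \<noteq> z))"
    if "finite N" "N \<inter> Z = {}" for N
    using that
  proof (induction N)
    case empty
    show ?case using s0 by (intro exI[of _ "{}"] exI[of _ S]) (use openin_topspace[of T] in simp)
  next
    case (insert p N)
    then obtain Z1 Q1 where 1: "finite Z1" "Z1 \<subseteq> Z" "openin T Q1" "s\<^sub>0 \<in> Q1"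
      "\<forall>s\<in>Q1. s a\<^sub>0 \<noteq> s\<^sub>0 a\<^sub>0 \<longrightarrow> (\<forall>(x, z)\<in>Z1. s x = z) \<longrightarrow> (\<forall>(x, z)\<in>N. s x \<noteq> z)" by blast
    have "\<not> consistent (Set.insert p Z)" using insert.prems Z(2) by blast
    then obtain Z2 Q2 where 2: "finite Z2" "Z2 \<subseteq> Set.insert p Z" "openin T Q2" "s\<^sub>0 \<in> Q2"
      "\<forall>s\<in>Q2. s a\<^sub>0 \<noteq> s\<^sub>0 a\<^sub>0 \<longrightarrow> \<not> (\<forall>(x, z)\<in>Z2. s x = z)" unfolding consistent_def by blast
    have "\<forall>s\<in>Q1 \<inter> Q2. s a\<^sub>0 \<noteq> s\<^sub>0 a\<^sub>0 \<longrightarrow> (\<forall>(x, z)\<in>Z1 \<union> (Z2 - {p}). s x = z) \<longrightarrow>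
        (\<forall>(x, z)\<in>Set.insert p N. s x \<noteq> z)"
    proof (rule ballI, rule impI, rule impI)
      fix s assume s: "s \<in> Q1 \<inter> Q2" "s a\<^sub>0 \<noteq> s\<^sub>0 a\<^sub>0" "\<forall>(x, z)\<in>Z1 \<union> (Z2 - {p}). s x = z"
      have "s \<in> Q1" "s \<in> Q2" "\<forall>(x, z)\<in>Z1. s x = z" using s(1,3) by auto
      then have N: "\<forall>(x, z)\<in>N. s x \<noteq> z" and "\<not> (\<forall>(x, z)\<in>Z2. s x = z)"
        using 1(5) 2(5) s(2) by simp_all
      then obtain q where q: "q \<in> Z2" "\<not> (case q of (x, z) \<Rightarrow> s x = z)" by blast
      \<comment> \<open>All constraints of \<open>Z2\<close> other than \<open>p\<close> are met, so
        the one violated must be \<open>p\<close>.\<close>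
      have "q = p"
      proof (rule ccontr)
        assume "q \<noteq> p"
        then show False using bspec[OF s(3), of q] q by simp
      qed
      then have "\<not> (case p of (x, z) \<Rightarrow> s x = z)" using q(2) by simp
      then show "\<forall>(x, z)\<in>Set.insert p N. s x \<noteq> z" using N by auto
    qed
    moreover have "Z1 \<union> (Z2 - {p}) \<subseteq> Z" "finite (Z1 \<union> (Z2 - {p}))" using 1 2 by auto
    moreover have "openin T (Q1 \<inter> Q2)" "s\<^sub>0 \<in> Q1 \<inter> Q2" using 1 2 by auto
    ultimately show ?case
      by (intro exI[of _ "Z1 \<union> (Z2 - {p})"] exI[of _ "Q1 \<inter> Q2"] conjI)
  qed
  define \<sigma> where "\<sigma> = (\<lambda>x. SOME z. (x, z) \<in> Z)"
  have \<sigma>: "(x, \<sigma> x) \<in> Z" if "x \<in> Domain Z" for x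
    using that unfolding \<sigma>_def by (metis Domain.cases someI)
  show thesis
  proof (rule that)
    fix X A :: "'a set" and Q
    assume X: "finite X" and A: "finite A" and Q: "openin T Q" "s\<^sub>0 \<in> Q"
    have "finite ((X - Domain Z) \<times> A)" "(X - Domain Z) \<times> A \<inter> Z = {}" using X A by auto
    from avoid[OF this] obtain Z' Q' where Z': "finite Z'" "Z' \<subseteq> Z" "openin T Q'" "s\<^sub>0 \<in> Q'"
      "\<forall>s\<in>Q'. s a\<^sub>0 \<noteq> s\<^sub>0 a\<^sub>0 \<longrightarrow> (\<forall>(x, z)\<in>Z'. s x = z) \<longrightarrow>
        (\<forall>(x, z)\<in>(X - Domain Z) \<times> A. s x \<noteq> z)" by blast
    let ?Z = "Z' \<union> (\<lambda>x. (x, \<sigma> x)) ` (X \<inter> Domain Z)"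
    have "?Z \<subseteq> Z" using Z'(2) \<sigma> by blast
    moreover have "finite ?Z" "openin T (Q \<inter> Q')" "s\<^sub>0 \<in> Q \<inter> Q'" using Z' X Q by auto
    ultimately have "\<exists>s\<in>Q \<inter> Q'. s a\<^sub>0 \<noteq> s\<^sub>0 a\<^sub>0 \<and> (\<forall>(x, z)\<in>?Z. s x = z)"
      by (intro Z(1)[unfolded consistent_def, rule_format])
    then obtain s where s: "s \<in> Q \<inter> Q'" "s a\<^sub>0 \<noteq> s\<^sub>0 a\<^sub>0" "\<forall>(x, z)\<in>?Z. s x = z"
      by (elim bexE conjE)
    have "s \<in> Q'" "\<forall>(x, z)\<in>Z'. s x = z" using s(1,3) by simp_all
    then have N: "\<forall>(x, z)\<in>(X - Domain Z) \<times> A. s x \<noteq> z" using Z'(5) s(2) by simp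
    have "if x \<in> Domain Z then s x = \<sigma> x else s x \<notin> A" if x: "x \<in> X" for x
    proof (cases "x \<in> Domain Z")
      case True
      then have "(x, \<sigma> x) \<in> ?Z" using x by blast
      then show ?thesis using bspec[OF s(3)] True by fastforce
    next
      case False
      have "s x \<notin> A"
      proof
        assume "s x \<in> A"
        then show False using bspec[OF N, of "(x, s x)"] x False by simp
      qed
      then show ?thesis using False by simp
    qed
    moreover have "s \<in> Q" using s(1) by simp
    ultimately show "\<exists>s\<in>Q. s a\<^sub>0 \<noteq> s\<^sub>0 a\<^sub>0 \<and> (\<forall>x\<in>X. if x \<in> Domain Z then s x = \<sigma> x else s x \<notin> A)"
      using s(2) by (intro bexI[of _ s] conjI ballI)
  qed
qed

lemma contradiction: False
proof -
  obtain V \<sigma> where limit: "\<And>X A Q. finite X \<Longrightarrow> finite A \<Longrightarrow> openin T Q \<Longrightarrow> s\<^sub>0 \<in> Q \<Longrightarrow>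
    \<exists>s\<in>Q. s a\<^sub>0 \<noteq> s\<^sub>0 a\<^sub>0 \<and> (\<forall>x\<in>X. if x \<in> V then s x = \<sigma> x else s x \<notin> A)"
    using partial_limit by blast
  have openS: "openin T S" using openin_topspace[of T] by simp
  have limit_S: "\<exists>s\<in>S. (\<forall>x\<in>X \<inter> V. s x = \<sigma> x) \<and> (\<forall>x\<in>X - V. s x \<notin> A)"
    if fin: "finite X" "finite A" for X A
  proof -
    obtain s where "s \<in> S" "\<forall>x\<in>X. if x \<in> V then s x = \<sigma> x else s x \<notin> A"
      using limit[OF fin openS s0] by blast
    then show ?thesis by (intro bexI[of _ s]) auto
  qed
  have V: "alg_closed V" unfolding alg_closed_def
  proof (intro allI impI subsetI)
    fix F x assume F: "finite F" "F \<subseteq> V" and x: "x \<in> cl F"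
    obtain s where s: "s \<in> S" "\<forall>x\<in>Set.insert x F \<inter> V. s x = \<sigma> x" "\<forall>x\<in>Set.insert x F - V. s x \<notin> cl (\<sigma> ` F)"
      using limit_S[of "Set.insert x F" "cl (\<sigma> ` F)"] F(1) finite_acl by auto
    have "s ` F = \<sigma> ` F" using s(2) F(2) by (intro image_cong) auto
    then have "s x \<in> cl (\<sigma> ` F)" using acl_closure_image[OF s(1) F(1)] x by auto
    then show "x \<in> V" using s(3) by blast
  qed
  have inj_\<sigma>: "inj_on \<sigma> V"
  proof (rule inj_onI)
    fix x y assume xy: "x \<in> V" "y \<in> V" "\<sigma> x = \<sigma> y"
    obtain s where s: "s \<in> S" "\<forall>z\<in>{x, y} \<inter> V. s z = \<sigma> z" using limit_S[of "{x, y}" "{}"] by blast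
    then have "s x = s y" using xy by simp
    then show "x = y" using closure_inj[OF s(1)] by (simp add: injD)
  qed
  have closed_\<sigma>: "alg_closed (\<sigma> ` (V \<inter> W))" if W: "alg_closed W" for W
    unfolding alg_closed_def
  proof (intro allI impI)
    fix F assume "finite F" "F \<subseteq> \<sigma> ` (V \<inter> W)"
    then obtain E where E: "E \<subseteq> V \<inter> W" "finite E" "F = \<sigma> ` E" using finite_subset_image by metis
    have clE: "cl E \<subseteq> V \<inter> W" using E V W unfolding alg_closed_def by blast
    obtain s where s: "s \<in> S" "\<forall>x\<in>cl E \<inter> V. s x = \<sigma> x"
      using limit_S[of "cl E" "{}"] finite_acl E(2) by blast
    have "s ` E = \<sigma> ` E" using s(2) E(1) subset_acl[of E] by (intro image_cong) auto
    moreover have "s ` cl E = \<sigma> ` cl E" using s(2) clE by (intro image_cong) auto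
    ultimately have "cl F = \<sigma> ` cl E" using acl_closure_image[OF s(1) E(2)] E(3) by simp
    then show "cl F \<subseteq> \<sigma> ` (V \<inter> W)" using clE by blast
  qed
  have recover: "s\<^sub>0 (c a) \<in> \<sigma> ` (V \<inter> range c)" if c: "c \<in> S" for c a
  proof (rule ccontr)
    let ?D = "\<sigma> ` (V \<inter> range c)"
    assume b: "s\<^sub>0 (c a) \<notin> ?D"
    have D: "alg_closed ?D" using closed_\<sigma> alg_closed_range c by blast
    obtain g h where gh: "g \<in> S" "h \<in> S" "g (s\<^sub>0 (c a)) \<noteq> h (s\<^sub>0 (c a))"
      and amalg: "\<And>A C e. finite A \<Longrightarrow> cl A = A \<Longrightarrow> finite C \<Longrightarrow> cl C = C \<Longrightarrow> e \<in> S \<Longrightarrow>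
        A \<inter> e ` C \<subseteq> ?D \<Longrightarrow>
        \<exists>e'\<in>S. \<exists>p\<in>S. \<exists>p'\<in>S. (\<forall>x\<in>C. e' x = e x) \<and> (\<forall>x\<in>A. p x = g x) \<and> (\<forall>x\<in>A. p' x = h x) \<and>
          p \<circ> e' = p' \<circ> e'"
      by (fact separating_embeddings[OF D b])
    have s0c: "s\<^sub>0 \<circ> c \<in> S" using s0 c closure_comp by blast
    have "g \<circ> (s\<^sub>0 \<circ> c) \<in> S" "h \<circ> (s\<^sub>0 \<circ> c) \<in> S" using gh s0c closure_comp by blast+
    moreover have "g \<circ> (s\<^sub>0 \<circ> c) \<noteq> h \<circ> (s\<^sub>0 \<circ> c)" using gh(3) by (metis comp_apply)
    ultimately obtain U U' where U: "openin T U" "openin T U'" "g \<circ> (s\<^sub>0 \<circ> c) \<in> U"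
        "h \<circ> (s\<^sub>0 \<circ> c) \<in> U'" "U \<inter> U' = {}"
      using separate by metis
    \<comment> \<open>Neighbourhoods are chosen from the outside inwards: first for the left factors
      \<open>g\<close> and \<open>h\<close>, then for the two factors of
      \<open>s\<^sub>0 \<circ> c\<close>.\<close>
    obtain P R where P: "openin T P" "g \<in> P" and R: "openin T R" "s\<^sub>0 \<circ> c \<in> R"
      and PR: "\<And>p q. p \<in> P \<Longrightarrow> q \<in> R \<Longrightarrow> p \<circ> q \<in> U"
      using semigroup_topology_comp_nbhd[OF T gh(1) s0c U(1,3)] by metis
    obtain P' R' where P': "openin T P'" "h \<in> P'" and R': "openin T R'" "s\<^sub>0 \<circ> c \<in> R'"
      and PR': "\<And>p q. p \<in> P' \<Longrightarrow> q \<in> R' \<Longrightarrow> p \<circ> q \<in> U'"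
      using semigroup_topology_comp_nbhd[OF T gh(2) s0c U(2,4)] by metis
    have "openin T (R \<inter> R')" "s\<^sub>0 \<circ> c \<in> R \<inter> R'" using R R' by auto
    then obtain Q N where Q: "openin T Q" "s\<^sub>0 \<in> Q" and N: "openin T N" "c \<in> N"
      and QN: "\<And>p q. p \<in> Q \<Longrightarrow> q \<in> N \<Longrightarrow> p \<circ> q \<in> R \<inter> R'"
      using semigroup_topology_comp_nbhd[OF T s0 c] by metis
    obtain A1 where A1: "finite A1" "\<And>s. s \<in> S \<Longrightarrow> (\<And>x. x \<in> A1 \<Longrightarrow> s x = g x) \<Longrightarrow> s \<in> P"
      using T_nbhd[OF P] by blast
    obtain A2 where A2: "finite A2" "\<And>s. s \<in> S \<Longrightarrow> (\<And>x. x \<in> A2 \<Longrightarrow> s x = h x) \<Longrightarrow> s \<in> P'"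
      using T_nbhd[OF P'] by blast
    obtain C0 where C0: "finite C0" "\<And>s. s \<in> S \<Longrightarrow> (\<And>x. x \<in> C0 \<Longrightarrow> s x = c x) \<Longrightarrow> s \<in> N"
      using T_nbhd[OF N] by blast
    define A where "A = cl (A1 \<union> A2)"
    define C where "C = cl C0"
    have A: "finite A" "cl A = A" "A1 \<union> A2 \<subseteq> A"
      using A1 A2 finite_acl acl_acl subset_acl[of "A1 \<union> A2"] by (auto simp: A_def)
    have C: "finite C" "cl C = C" "C0 \<subseteq> C"
      using C0 finite_acl acl_acl subset_acl[of C0] by (auto simp: C_def)
    have "finite (c ` C)" using C(1) by blast
    \<comment> \<open>At points of the image of \<open>C\<close> outside \<open>V\<close>,
      \<open>s\<close> avoids \<open>A\<close>; hence \<open>A\<close> meets the image of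
      \<open>C\<close> under \<open>s \<circ> c\<close> only inside \<open>?D\<close>.\<close>
    from limit[OF this A(1) Q] obtain s where s: "s \<in> Q"
      "\<forall>x\<in>c ` C. if x \<in> V then s x = \<sigma> x else s x \<notin> A" by blast
    have sS: "s \<in> S" using s(1) openin_T_subset[OF Q(1)] by blast
    have "A \<inter> (s \<circ> c) ` C \<subseteq> ?D"
    proof
      fix z assume "z \<in> A \<inter> (s \<circ> c) ` C"
      then obtain x where x: "x \<in> C" "z = s (c x)" "z \<in> A" by auto
      then have "c x \<in> V \<and> s (c x) = \<sigma> (c x)" using bspec[OF s(2), of "c x"] by (auto split: if_splits)
      then show "z \<in> ?D" using x by auto
    qed
    then obtain e p p' where e: "e \<in> S" "p \<in> S" "p' \<in> S" "\<forall>x\<in>C. e x = (s \<circ> c) x"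
        "\<forall>x\<in>A. p x = g x" "\<forall>x\<in>A. p' x = h x" "p \<circ> e = p' \<circ> e"
      using amalg[OF A(1,2) C(1,2) closure_comp[OF sS c]] by blast
    obtain F where F: "finite F" "\<And>t. t \<in> S \<Longrightarrow> (\<And>x. x \<in> F \<Longrightarrow> t x = s x) \<Longrightarrow> t \<in> Q"
      using T_nbhd[OF Q(1) s(1)] by blast
    \<comment> \<open>The embedding \<open>e\<close> has to be a product of factors from
      \<open>Q\<close> and \<open>N\<close>. Approximating \<open>s\<close> by an invertible
      \<open>k\<close> allows the factorisation into \<open>k\<close> and
      \<open>inv k \<circ> e\<close>, with \<open>inv k \<circ> e\<close> agreeing with
      \<open>c\<close> on \<open>C0\<close>.\<close>
    obtain k where k: "k \<in> G" "\<And>x. x \<in> F \<union> c ` C \<Longrightarrow> k x = s x"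
      using closure_approx[OF sS, of "F \<union> c ` C"] F(1) C(1) by blast
    have "k \<in> Q" using k by (intro F(2) group_subset_closure) auto
    moreover have "inv k \<circ> e \<in> N"
    proof (rule C0(2))
      show "inv k \<circ> e \<in> S" using e(1) k(1) inv_mem group_subset_closure closure_comp by blast
      fix x assume "x \<in> C0"
      then have "e x = k (c x)" using e(4) C(3) k(2)[of "c x"] by auto
      then show "(inv k \<circ> e) x = c x" using inv_apply(1)[OF k(1)] by simp
    qed
    moreover have "k \<circ> (inv k \<circ> e) = e" using inv_apply(2)[OF k(1)] by (intro ext) simp
    ultimately have "e \<in> R \<inter> R'" using QN by metis
    moreover have "p \<in> P" using e(2,5) A(3) by (intro A1(2)) auto
    moreover have "p' \<in> P'" using e(3,6) A(3) by (intro A2(2)) auto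
    ultimately have "p \<circ> e \<in> U" "p' \<circ> e \<in> U'" using PR PR' by auto
    then show False using e(7) U(5) by auto
  qed
  have total: "a \<in> V" for a
  proof -
    let ?B = "cl {a}"
    \<comment> \<open>Applying \<open>recover\<close> to both embeddings gives two preimages under
      \<sigma>; injectivity on \<open>V\<close> identifies them, which places the preimage in
      \<open>?B\<close>.\<close>
    obtain c c' where c: "c \<in> S" "c' \<in> S" "\<And>x. x \<in> ?B \<Longrightarrow> c x = x" "\<And>x. x \<in> ?B \<Longrightarrow> c' x = x"
      "range c \<inter> range c' \<subseteq> ?B"
      using embeddings_meeting_in_acl[of "{a}"] by blast
    have "s\<^sub>0 ` ?B \<subseteq> \<sigma> ` (V \<inter> ?B)"
    proof
      fix z assume "z \<in> s\<^sub>0 ` ?B"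
      then obtain x where x: "x \<in> ?B" "z = s\<^sub>0 x" by blast
      have "z \<in> \<sigma> ` (V \<inter> range c)" "z \<in> \<sigma> ` (V \<inter> range c')"
        using recover[OF c(1), of x] recover[OF c(2), of x] c(3,4) x by simp_all
      then obtain w w' where "w \<in> V" "w \<in> range c" "w' \<in> V" "w' \<in> range c'" "z = \<sigma> w" "z = \<sigma> w'" by blast
      moreover from this have "w = w'" using inj_\<sigma> by (metis inj_onD)
      ultimately show "z \<in> \<sigma> ` (V \<inter> ?B)" using c(5) by blast
    qed
    moreover have fin: "finite ?B" using finite_acl by blast
    ultimately have "card (s\<^sub>0 ` ?B) \<le> card (V \<inter> ?B)"
      by (meson card_image_le card_mono finite_Int finite_imageI le_trans)
    moreover have "card (s\<^sub>0 ` ?B) = card ?B"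
      using closure_inj[OF s0] by (metis card_image inj_on_subset subset_UNIV)
    ultimately have "V \<inter> ?B = ?B" using fin by (metis Int_lower2 card_seteq)
    then show ?thesis using subset_acl[of "{a}"] by blast
  qed
  have \<sigma>: "\<sigma> \<in> S"
  proof (rule closure_memI)
    fix F :: "'a set" assume F: "finite F"
    obtain s where "s \<in> S" "\<forall>x\<in>F. s x = \<sigma> x" using limit_S[OF F, of "{}"] total by blast
    then show "\<exists>g\<in>G. \<forall>x\<in>F. g x = \<sigma> x" using closure_approx[OF _ F] by metis
  qed
  have "\<sigma> = s\<^sub>0"
  proof (rule ccontr)
    assume "\<sigma> \<noteq> s\<^sub>0"
    then obtain U Q where U: "openin T U" "openin T Q" "\<sigma> \<in> U" "s\<^sub>0 \<in> Q" "U \<inter> Q = {}"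
      using separate \<sigma> s0 by metis
    obtain F where F: "finite F" "\<And>s. s \<in> S \<Longrightarrow> (\<And>x. x \<in> F \<Longrightarrow> s x = \<sigma> x) \<Longrightarrow> s \<in> U"
      using T_nbhd[OF U(1,3)] by blast
    from limit[OF F(1) _ U(2,4), of "{}"] obtain s where s: "s \<in> Q" "\<forall>x\<in>F. s x = \<sigma> x"
      using total by auto
    then have "s \<in> U" using F(2) openin_T_subset[OF U(2)] by blast
    then show False using s(1) U(5) by blast
  qed
  \<comment> \<open>The limit \<sigma> inherits the disagreement with \<open>s\<^sub>0\<close> at
    \<open>a\<^sub>0\<close>, because \<open>a\<^sub>0\<close> lies in \<open>V\<close>.\<close>
  moreover obtain s where "s a\<^sub>0 \<noteq> s\<^sub>0 a\<^sub>0" "s a\<^sub>0 = \<sigma> a\<^sub>0"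
    using limit[OF _ _ openS s0, of "{a\<^sub>0}" "{}"] total by auto
  ultimately show False by simp
qed

end

section \<open>Minimality of the topology of pointwise convergence\<close>

theorem theorem6p16:
  fixes L :: "('f, 'r) language"
    and M :: "('f, 'r, 'a) struct"
    and G Gbar :: "('a \<Rightarrow> 'a) set"
  assumes "countable (UNIV :: 'a set)"
    and "infinite (UNIV :: 'a set)"
    and "saturated L M"
    and "G = automorphisms L M"
    and "Gbar = pointwise_topology closure_of G"
    and "locally_finite_acl G"
    and "base_monotone G"
  shows "minimal_Hausdorff_semigroup_topology Gbar (subtopology pointwise_topology Gbar)"
proof -
  interpret modular_perm_group G
  proof
    show "\<exists>m\<in>pointwise_closure G. \<exists>m'\<in>pointwise_closure G.
        (\<forall>(x, y)\<in>P. m' x = m y) \<and> (\<forall>(x, y)\<in>R. m' x \<noteq> m y)"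
      if "\<And>E N. finite E \<Longrightarrow> finite N \<Longrightarrow> E \<subseteq> P \<Longrightarrow> N \<subseteq> R \<Longrightarrow>
        \<exists>k\<in>G. (\<forall>(x, y)\<in>E. k x = y) \<and> (\<forall>(x, y)\<in>N. k x \<noteq> y)" for P R
      using saturated_pair_of_embeddings[OF assms(3,2,1)] that unfolding assms(4) by blast
    show "id \<in> G" "g \<in> G \<Longrightarrow> h \<in> G \<Longrightarrow> g \<circ> h \<in> G" "g \<in> G \<Longrightarrow> inv g \<in> G" "g \<in> G \<Longrightarrow> bij g" for g h
      unfolding assms(4) by (simp_all add: automorphism_group automorphism_bij)
    show "finite (acl G B)" if "finite B" for B
      using assms(6) that by (simp add: locally_finite_acl_def)
  qed (fact assms)+
  have Gbar: "Gbar = S" unfolding assms(5) by (rule pointwise_closure_of)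
  let ?T = "subtopology pointwise_topology Gbar"
  have "Hausdorff_semigroup_topology Gbar ?T"
    using closure_comp unfolding Gbar by (intro pointwise_Hausdorff_semigroup)
  moreover have "T' = ?T"
    if T': "Hausdorff_semigroup_topology Gbar T'" and coarse: "\<And>U. openin T' U \<Longrightarrow> openin ?T U" for T'
  proof -
    \<comment> \<open>A failure at \<open>s\<close> in the coordinate \<open>a\<close> is an
      instance of \<open>coarse_semigroup_topology\<close>, which is contradictory.\<close>
    have finer: "\<exists>Q. openin T' Q \<and> s \<in> Q \<and> (\<forall>t\<in>Q. t a = s a)" if s: "s \<in> S" for s a
    proof (rule ccontr)
      assume "\<not> ?thesis"
      then interpret coarse_semigroup_topology G T' s a
        using T' coarse s unfolding Gbar by unfold_locales blast+
      show False by (rule contradiction)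
    qed
    have top: "topspace T' = S" using T' by (simp add: Hausdorff_semigroup_topology_def Gbar)
    have "openin T' U" if U: "openin ?T U" for U
    proof (subst openin_subopen, intro ballI)
      fix s assume "s \<in> U"
      obtain V where V: "openin pointwise_topology V" "U = V \<inter> S"
        using U by (auto simp: openin_subtopology Gbar)
      have s: "s \<in> V" "s \<in> S" using \<open>s \<in> U\<close> V by auto
      obtain F where F: "finite F" "\<And>t. (\<And>x. x \<in> F \<Longrightarrow> t x = s x) \<Longrightarrow> t \<in> V"
        using openin_pointwise_nbhd[OF V(1) s(1)] by blast
      \<comment> \<open>A basic pointwise neighbourhood restricts finitely many coordinates, so
        finitely many neighbourhoods from \<open>finer\<close> are intersected.\<close>
      have "\<exists>Q. openin T' Q \<and> s \<in> Q \<and> (\<forall>t\<in>Q. \<forall>x\<in>F. t x = s x)" using F(1)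
      proof (induction F)
        case empty
        show ?case using openin_topspace[of T'] s top by auto
      next
        case (insert x F)
        then obtain Q where Q: "openin T' Q" "s \<in> Q" "\<forall>t\<in>Q. \<forall>x\<in>F. t x = s x" by blast
        obtain Q' where Q': "openin T' Q'" "s \<in> Q'" "\<forall>t\<in>Q'. t x = s x" using finer s(2) by blast
        have "openin T' (Q \<inter> Q')" "s \<in> Q \<inter> Q'" using Q(1,2) Q'(1,2) by auto
        moreover have "t y = s y" if "t \<in> Q \<inter> Q'" "y \<in> Set.insert x F" for t y
          using that Q(3) Q'(3) by blast
        ultimately show ?case by blast
      qed
      then obtain Q where Q: "openin T' Q" "s \<in> Q" "\<forall>t\<in>Q. \<forall>x\<in>F. t x = s x" by blast
      have "Q \<subseteq> U"
      proof
        fix t assume "t \<in> Q"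
        then have "t \<in> S" "t \<in> V" using openin_subset[OF Q(1)] top Q(3) F(2)[of t] by blast+
        then show "t \<in> U" by (simp add: V(2))
      qed
      then show "\<exists>Q. openin T' Q \<and> s \<in> Q \<and> Q \<subseteq> U" using Q by blast
    qed
    then show ?thesis using coarse by (auto simp: topology_eq)
  qed
  ultimately show ?thesis
    unfolding minimal_Hausdorff_semigroup_topology_def strictly_coarser_def by blast
qed

end
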